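(* Let $(\mathcal{X},d)$ be a Polish space, $\mu\in\mathcal{P}(\mathcal{X})$, and let $c$ be a power type cost function with exponent $p_o$ and $\tilde d=c^{1/p_o}$. Suppose there exist $a'>0$ and $r_o\ge0$ such that for every Borel $A\subset\mathcal{X}$ with $\mu(A)\ge1/2$, $\mu(A_r)\ge1-e^{-(r-r_o)^{p_o}/a'}$ for all $r\ge r_o$, where $A_r=\{x:\exists y\in A,\ \tilde d(x,y)\le r\}$. Then for all $a>a'$, the functional $F_a(\nu)=aH(\nu|\mu)-\mathcal{T}_c(\nu,\mu)$ admits at least one minimizer on $\mathcal{P}_\mu(\mathcal{X})$.
   Context: A power type cost function is $c(x,y)=\phi(d(x,y))$ with $\phi:\mathbb{R}^+\to\mathbb{R}^+$ convex, $\phi(0)=0$, $\phi(x)>0$ for $x>0$, $\sup_{x>0}\phi(2x)/\phi(x)<\infty$; its exponent is $p_o=\sup_{x>0}x\phi'(x)/\phi(x)$ ($\phi'$ the right derivative), and $\tilde d=c^{1/p_o}$ is a distance. $H(\nu|\mu)=\int\log(d\nu/d\mu)\,d\nu$ if $\nu\ll\mu$, $+\infty$ otherwise; $\mathcal{P}_\mu(\mathcal{X})=\{\nu:H(\nu|\mu)<\infty\}$; $\mathcal{T}_c(\nu_1,\nu_2)=\inf_\pi\iint c\,d\pi$ over couplings $\pi$ of $\nu_1,\nu_2$. *)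

theory Defs
  imports "HOL-Probability.Probability"
begin

definition right_deriv :: "(real \<Rightarrow> real) \<Rightarrow> real \<Rightarrow> real" where
  "right_deriv \<phi> x = Lim (at_right x) (\<lambda>t. (\<phi> t - \<phi> x) / (t - x))"

definition power_type :: "(real \<Rightarrow> real) \<Rightarrow> bool" where
  "power_type \<phi> \<longleftrightarrow> convex_on {0..} \<phi> \<and> \<phi> 0 = 0 \<and> (\<forall>x>0. \<phi> x > 0)
     \<and> bdd_above ((\<lambda>x. \<phi> (2*x) / \<phi> x) ` {0<..})"

definition power_exponent :: "(real \<Rightarrow> real) \<Rightarrow> real" where
  "power_exponent \<phi> = (SUP x\<in>{0<..}. x * right_deriv \<phi> x / \<phi> x)"

definition prob_measures :: "'a::topological_space measure set" where
  "prob_measures = {\<nu>. prob_space \<nu> \<and> sets \<nu> = sets borel}"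

text \<open>Relative entropy H(nu|mu) = int log(dnu/dmu) dnu if nu << mu, +infinity otherwise.
  The integral is split into positive and negative parts (the negative part is always finite).\<close>
definition rel_entropy :: "'a measure \<Rightarrow> 'a measure \<Rightarrow> ereal" where
  "rel_entropy \<nu> \<mu> =
     (if absolutely_continuous \<mu> \<nu> then
        enn2ereal (\<integral>\<^sup>+ x. ennreal (max 0 (log (exp 1) (enn2real (RN_deriv \<mu> \<nu> x)))) \<partial>\<nu>)
      - enn2ereal (\<integral>\<^sup>+ x. ennreal (max 0 (- log (exp 1) (enn2real (RN_deriv \<mu> \<nu> x)))) \<partial>\<nu>)
      else \<infinity>)"

definition couplings :: "'a::topological_space measure \<Rightarrow> 'a measure \<Rightarrow> ('a \<times> 'a) measure set" where
  "couplings \<nu>1 \<nu>2 = {\<pi>. prob_space \<pi> \<and> sets \<pi> = sets (borel \<Otimes>\<^sub>M borel)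
      \<and> distr \<pi> borel fst = \<nu>1 \<and> distr \<pi> borel snd = \<nu>2}"

definition transport_cost :: "('a \<Rightarrow> 'a \<Rightarrow> real) \<Rightarrow> 'a::topological_space measure \<Rightarrow> 'a measure \<Rightarrow> ennreal" where
  "transport_cost c \<nu>1 \<nu>2 = (INF \<pi>\<in>couplings \<nu>1 \<nu>2. \<integral>\<^sup>+ z. ennreal (c (fst z) (snd z)) \<partial>\<pi>)"

definition enlargement :: "('a \<Rightarrow> 'a \<Rightarrow> real) \<Rightarrow> 'a set \<Rightarrow> real \<Rightarrow> 'a set" where
  "enlargement dt A r = {x. \<exists>y\<in>A. dt x y \<le> r}"

end

theory Submission
  imports Defs "HOL-Real_Asymp.Real_Asymp"
begin

text \<open>
  Write \<open>h = c(\<cdot>, x\<^sub>0)\<close>. Concentration around a ball of mass at least \<open>1/2\<close> gives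
  \<open>\<integral> exp (h / b) d\<mu> < \<infinity>\<close> for every \<open>b > a'\<close>, so by the Donsker--Varadhan inequality
  \<open>T\<^sub>c(\<nu>, \<mu>) \<le> A b H(\<nu>|\<mu>) + const\<close> for every \<open>A > 1\<close>. Hence \<open>F\<^sub>a\<close> is bounded below and a
  minimizing sequence has bounded entropy. Bounded entropy means uniform absolute continuity with
  respect to \<open>\<mu>\<close>, so a subsequence \<open>\<nu>\<^sub>n\<close> converges setwise to some \<open>\<nu>\<close>.

  The transport cost need not be upper semicontinuous along \<open>\<nu>\<^sub>n\<close>, because mass may escape to
  infinity, but \<open>F\<^sub>a\<close> is lower semicontinuous. Take a coupling \<open>\<pi>\<close> of \<open>\<nu>\<close> and \<open>\<mu>\<close> and a
  countable partition into small cells. Transporting \<open>\<nu>\<^sub>n\<close> to \<open>\<nu>\<close> inside the cells, up to the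
  vanishing discrepancy of the cell masses, and then following \<open>\<pi>\<close>, gives a coupling of \<open>\<nu>\<^sub>n\<close>
  and \<open>\<mu>\<close> of cost at most \<open>A \<integral> c d\<pi> + A \<integral>\<^bsub>h > M\<^esub> h d\<nu>\<^sub>n + o(1)\<close>. The middle term is
  absorbed by \<open>a H(\<nu>\<^sub>n|\<mu>)\<close>: in the Donsker--Varadhan inequality use the test function \<open>h / b\<close>
  on \<open>{h > M}\<close> and a nearly optimal bounded test function for \<open>\<nu>\<close> elsewhere.
\<close>

section \<open>Power type cost functions\<close>

text \<open>\<open>Lim\<close> says nothing unless the limit exists. Convexity makes the difference
  quotients at x nondecreasing to the right of x and bounds them below by the slope from s, so they
  converge to their infimum, and both estimates compare with that infimum.\<close>

lemma convex_right_deriv_bounds: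
  fixes \<phi> :: "real \<Rightarrow> real"
  assumes \<phi>: "convex_on {0..} \<phi>" and s: "0 \<le> s" "s < x" and t: "x < t"
  shows "(\<phi> x - \<phi> s) / (x - s) \<le> right_deriv \<phi> x"
    and "right_deriv \<phi> x \<le> (\<phi> t - \<phi> x) / (t - x)"
proof -
  define q where "q \<equiv> \<lambda>t. (\<phi> t - \<phi> x) / (t - x)"
  have mono: "q a \<le> q b" if "x < a" "a \<le> b" for a b
  proof (cases "a = b")
    case False
    then have "(\<phi> x - \<phi> a) / (x - a) \<le> (\<phi> x - \<phi> b) / (x - b)"
      using convex_on_slope_le(1)[OF \<phi>, of x b a] that s by auto
    moreover have "(\<phi> x - \<phi> u) / (x - u) = q u" for u
      unfolding q_def by (metis minus_diff_eq minus_divide_divide)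
    ultimately show ?thesis by simp
  qed simp
  have lower: "(\<phi> x - \<phi> s) / (x - s) \<le> q a" if "x < a" for a
  proof -
    have "(\<phi> s - \<phi> x) / (s - x) \<le> (\<phi> s - \<phi> a) / (s - a)"
      "(\<phi> s - \<phi> a) / (s - a) \<le> (\<phi> x - \<phi> a) / (x - a)"
      using convex_on_slope_le[OF \<phi>, of s a x] that s by auto
    then show ?thesis unfolding q_def by (metis minus_diff_eq minus_divide_divide order_trans)
  qed
  have "(q \<longlongrightarrow> Inf (q ` ({x<..} \<inter> UNIV))) (at x within ({x<..} \<inter> UNIV))"
    using mono lower by (intro Lim_right_bound) auto
  then have "right_deriv \<phi> x = Inf (q ` {x<..})"
    unfolding right_deriv_def q_def by (intro tendsto_Lim) auto
  then show "(\<phi> x - \<phi> s) / (x - s) \<le> right_deriv \<phi> x"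
    "right_deriv \<phi> x \<le> (\<phi> t - \<phi> x) / (t - x)"
    using lower t unfolding q_def
    by (auto intro!: cINF_greatest cINF_lower bdd_belowI2)
qed

lemma power_type_nonneg: "power_type \<phi> \<Longrightarrow> 0 \<le> x \<Longrightarrow> 0 \<le> \<phi> x"
  unfolding power_type_def by (metis less_eq_real_def)

lemma power_type_le_linear:
  assumes "power_type \<phi>" "0 \<le> x" "0 \<le> s" "s \<le> 1"
  shows "\<phi> (s * x) \<le> s * \<phi> x"
proof -
  have "convex_on {0..} \<phi>" "\<phi> 0 = 0" using assms by (auto simp: power_type_def)
  then show ?thesis using convex_onD[of "{0..}" \<phi> s 0 x] assms by auto
qed

lemma power_type_mono:
  assumes "power_type \<phi>" "0 \<le> x" "x \<le> y"
  shows "\<phi> x \<le> \<phi> y"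
proof (cases "y = 0")
  case False
  then have "\<phi> (x / y * y) \<le> x / y * \<phi> y"
    using assms by (intro power_type_le_linear) auto
  also have "\<dots> \<le> 1 * \<phi> y"
    using assms False by (intro mult_right_mono power_type_nonneg[OF assms(1)]) auto
  finally show ?thesis using False by simp
qed (use assms in auto)

text \<open>The hypotheses control \<phi> only on [0, \<infinity>), hence the clamp. The clamped
  function is monotone, and on distances the clamp is invisible.\<close>

lemma power_type_measurable:
  assumes "power_type \<phi>"
  shows "(\<lambda>x. \<phi> (max 0 x)) \<in> borel_measurable borel"
  by (intro borel_measurable_mono monoI power_type_mono[OF assms]) auto

text \<open>A real \<open>SUP\<close> bounds its members only when the set is bounded. The doubling
  condition supplies this: by the chord from y to 2y, y \<phi>'(y) \<le> \<phi>(2y) -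
  \<phi>(y).\<close>

lemma power_exponent_upper:
  assumes "power_type \<phi>" "0 < x"
  shows "right_deriv \<phi> x \<le> power_exponent \<phi> * \<phi> x / x"
proof -
  have cv: "convex_on {0..} \<phi>" and pos: "\<And>x. x > 0 \<Longrightarrow> \<phi> x > 0"
    and "bdd_above ((\<lambda>x. \<phi> (2*x) / \<phi> x) ` {0<..})" using assms by (auto simp: power_type_def)
  then obtain K where K: "\<And>x. x > 0 \<Longrightarrow> \<phi> (2*x) / \<phi> x \<le> K"
    unfolding bdd_above_def by auto
  have "y * right_deriv \<phi> y / \<phi> y \<le> K" if "y > 0" for y
  proof -
    have "right_deriv \<phi> y \<le> (\<phi> (2*y) - \<phi> y) / (2*y - y)"
      using convex_right_deriv_bounds(2)[OF cv, of 0 y "2*y"] that by auto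
    then have "y * right_deriv \<phi> y \<le> \<phi> (2*y) - \<phi> y" using that by (simp add: field_simps)
    then have "y * right_deriv \<phi> y / \<phi> y \<le> (\<phi> (2*y) - \<phi> y) / \<phi> y"
      using pos[OF that] by (intro divide_right_mono) auto
    also have "\<dots> \<le> \<phi> (2*y) / \<phi> y" using pos[OF that] by (intro divide_right_mono) auto
    finally show ?thesis using K[OF that] by linarith
  qed
  then have "x * right_deriv \<phi> x / \<phi> x \<le> power_exponent \<phi>"
    unfolding power_exponent_def using assms(2) by (intro cSUP_upper bdd_aboveI2) auto
  then show ?thesis using pos[OF assms(2)] assms(2) by (simp add: field_simps)
qed

text \<open>The chord of \<phi> from 0 to 1 has slope \<phi>(1), which convexity puts below the
  right derivative at 1. The bound later allows \<open>powr p\<close> to cancel against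
  \<open>powr (1 / p)\<close>.\<close>

lemma power_exponent_ge_1:
  assumes "power_type \<phi>"
  shows "1 \<le> power_exponent \<phi>"
proof -
  have "convex_on {0..} \<phi>" "\<phi> 0 = 0" "\<phi> 1 > 0" using assms by (auto simp: power_type_def)
  then have "\<phi> 1 \<le> right_deriv \<phi> 1"
    using convex_right_deriv_bounds(1)[of \<phi> 0 1 2] by auto
  also have "\<dots> \<le> power_exponent \<phi> * \<phi> 1" using power_exponent_upper[OF assms, of 1] by simp
  finally show ?thesis using \<open>\<phi> 1 > 0\<close> by simp
qed

text \<open>The chord from s * y to y is no steeper than the right derivative at y, which is at most
  p \<phi>(y) / y. The factor 1 - p (1 - s) agrees with s^p to first order at s = 1, which suffices
  once the step is iterated.\<close>

lemma power_type_contract_step: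
  assumes "power_type \<phi>" "0 < y" "0 \<le> s" "s \<le> 1"
  shows "(1 - power_exponent \<phi> * (1 - s)) * \<phi> y \<le> \<phi> (s * y)"
proof (cases "s = 1")
  case False
  have cv: "convex_on {0..} \<phi>" using assms by (auto simp: power_type_def)
  have lt: "s * y < y" using assms False by simp
  have "(\<phi> y - \<phi> (s * y)) / (y - s * y) \<le> power_exponent \<phi> * \<phi> y / y"
    using convex_right_deriv_bounds(1)[OF cv _ lt, of "y + 1"] power_exponent_upper[OF assms(1,2)] assms
    by (auto intro: order_trans)
  then have "\<phi> y - \<phi> (s * y) \<le> power_exponent \<phi> * \<phi> y / y * (y - s * y)"
    using lt by (simp add: pos_divide_le_eq)
  also have "\<dots> = power_exponent \<phi> * \<phi> y * (1 - s)" using assms by (simp add: field_simps)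
  finally show ?thesis by (simp add: algebra_simps)
qed simp

lemma power_type_contract_power:
  assumes "power_type \<phi>" "0 < y" "0 < s" "s \<le> 1" "0 \<le> 1 - power_exponent \<phi> * (1 - s)"
  shows "(1 - power_exponent \<phi> * (1 - s)) ^ n * \<phi> y \<le> \<phi> (s ^ n * y)"
proof (induction n)
  case (Suc n)
  let ?l = "1 - power_exponent \<phi> * (1 - s)"
  have "?l ^ Suc n * \<phi> y = ?l * (?l ^ n * \<phi> y)" by simp
  also have "\<dots> \<le> ?l * \<phi> (s ^ n * y)" using Suc assms by (intro mult_left_mono) auto
  also have "\<dots> \<le> \<phi> (s * (s ^ n * y))" using assms by (intro power_type_contract_step) auto
  finally show ?case by (simp add: mult.assoc)
qed simp

text \<open>Composing the infinitesimal bound \<open>n\<close> times with ratio \<open>t powr (1/n)\<close> and letting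
  \<open>n\<close> tend to infinity integrates the differential inequality \<open>x \<phi>' \<le> p \<phi>\<close>.\<close>
lemma power_type_contract:
  assumes "power_type \<phi>" "0 \<le> y" "0 < t" "t \<le> 1"
  shows "t powr power_exponent \<phi> * \<phi> y \<le> \<phi> (t * y)"
proof (cases "y = 0")
  case False
  define p where "p = power_exponent \<phi>"
  define l where "l \<equiv> \<lambda>n. 1 - p * (1 - t powr (1 / real n))"
  define k where "k = ln t"
  have l: "l = (\<lambda>n. 1 - p * (1 - exp (k / real n)))"
    unfolding l_def k_def using \<open>t > 0\<close> by (simp add: powr_def)
  have lim1: "l \<longlonglongrightarrow> 1" unfolding l by real_asymp
  have "(\<lambda>n. l n ^ n) \<longlonglongrightarrow> exp (k * p)" unfolding l by real_asymp
  then have lim: "(\<lambda>n. l n ^ n) \<longlonglongrightarrow> t powr p"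
    unfolding k_def using \<open>t > 0\<close> by (simp add: powr_def mult.commute)
  \<comment> \<open>Iterating the one-step bound needs a nonnegative factor, available for large n
    because \<open>l\<close> tends to 1.\<close>
  have "\<forall>\<^sub>F n in sequentially. l n > 0" using lim1 by (rule order_tendstoD) simp
  then have "\<forall>\<^sub>F n in sequentially. l n ^ n * \<phi> y \<le> \<phi> (t * y)"
    using eventually_gt_at_top[of 0]
  proof eventually_elim
    case (elim n)
    have "l n ^ n * \<phi> y \<le> \<phi> ((t powr (1 / real n)) ^ n * y)"
      using elim assms False powr_mono2[of "1/real n" t 1] unfolding l_def p_def
      by (intro power_type_contract_power) auto
    also have "(t powr (1 / real n)) ^ n = t" using elim assms by (simp add: powr_power)
    finally show ?case .
  qed
  then show ?thesis unfolding p_def[symmetric]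
    by (intro tendsto_upperbound[OF tendsto_mult_right[OF lim]]) auto
qed (use assms in \<open>auto simp: power_type_def\<close>)

lemma power_type_dilate:
  assumes "power_type \<phi>" "0 \<le> y" "1 \<le> t"
  shows "\<phi> (t * y) \<le> t powr power_exponent \<phi> * \<phi> y"
proof -
  have "(1/t) powr power_exponent \<phi> * \<phi> (t * y) \<le> \<phi> (1/t * (t * y))"
    using assms by (intro power_type_contract) auto
  then show ?thesis using assms by (simp add: powr_divide field_simps)
qed

text \<open>Choose e with (1 + e)^p = A. Either t \<le> e s and s + t \<le> (1 + e) s, or t > e s
  and s + t \<le> (1 + 1/e) t, and dilation bounds each case by a single term. The factor of
  \<phi>(s) can thus be as close to 1 as desired, at the expense of C.\<close>

lemma power_type_almost_subadditive:
  assumes "power_type \<phi>" "1 < A"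
  obtains C where "0 \<le> C" "\<And>s t. 0 \<le> s \<Longrightarrow> 0 \<le> t \<Longrightarrow> \<phi> (s + t) \<le> A * \<phi> s + C * \<phi> t"
proof -
  define p where "p = power_exponent \<phi>"
  have p: "p \<ge> 1" unfolding p_def by (rule power_exponent_ge_1[OF assms(1)])
  define e where "e = A powr (1/p) - 1"
  have "1 powr (1/p) < A powr (1/p)" using assms p by (intro powr_less_mono2) auto
  then have e: "e > 0" unfolding e_def by simp
  have eA: "(1 + e) powr p = A" unfolding e_def using assms p by (simp add: powr_powr)
  show thesis
  proof
    show "0 \<le> (1 + 1/e) powr p" by simp
    fix s t :: real assume st: "0 \<le> s" "0 \<le> t"
    have nn: "0 \<le> \<phi> s" "0 \<le> \<phi> t" using st assms by (auto intro: power_type_nonneg)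
    show "\<phi> (s + t) \<le> A * \<phi> s + (1 + 1/e) powr p * \<phi> t"
    proof (cases "t \<le> e * s")
      case True
      then have "\<phi> (s + t) \<le> \<phi> ((1 + e) * s)"
        using st by (intro power_type_mono[OF assms(1)]) (auto simp: algebra_simps)
      also have "\<dots> \<le> A * \<phi> s"
        using power_type_dilate[OF assms(1) st(1), of "1 + e"] e eA by (simp add: p_def)
      finally show ?thesis using nn by (simp add: add_increasing2)
    next
      case False
      then have "\<phi> (s + t) \<le> \<phi> ((1 + 1/e) * t)"
        using st e by (intro power_type_mono[OF assms(1)]) (auto simp: field_simps)
      also have "\<dots> \<le> (1 + 1/e) powr p * \<phi> t"
        using power_type_dilate[OF assms(1) st(2), of "1 + 1/e"] e by (simp add: p_def)
      finally show ?thesis using nn assms by (simp add: add_increasing)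
    qed
  qed
qed

section \<open>The Donsker--Varadhan formula\<close>

lemma absolutely_continuous_density_real:
  assumes "prob_space \<mu>" "prob_space \<nu>" "sets \<nu> = sets \<mu>" "absolutely_continuous \<mu> \<nu>"
  shows "\<nu> = density \<mu> (\<lambda>x. ennreal (enn2real (RN_deriv \<mu> \<nu> x)))"
proof -
  interpret M: prob_space \<mu> by fact
  interpret N: prob_space \<nu> by fact
  have "density \<mu> (RN_deriv \<mu> \<nu>) = \<nu>" using assms by (intro M.density_RN_deriv) auto
  moreover have "AE x in \<mu>. RN_deriv \<mu> \<nu> x \<noteq> \<infinity>"
    using assms N.sigma_finite_measure_axioms by (intro M.RN_deriv_finite) auto
  then have "density \<mu> (RN_deriv \<mu> \<nu>) = density \<mu> (\<lambda>x. ennreal (enn2real (RN_deriv \<mu> \<nu> x)))"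
    by (intro density_cong) (auto simp: less_top)
  ultimately show ?thesis by simp
qed

lemma prob_density_integral:
  fixes f :: "'a \<Rightarrow> real"
  assumes [measurable]: "f \<in> borel_measurable \<mu>" and f0: "\<And>x. 0 \<le> f x"
    and "prob_space (density \<mu> (\<lambda>x. ennreal (f x)))"
  shows "integrable \<mu> f" "(\<integral>x. f x \<partial>\<mu>) = 1"
proof -
  interpret prob_space "density \<mu> (\<lambda>x. ennreal (f x))" by fact
  have "integrable (density \<mu> (\<lambda>x. ennreal (f x))) (\<lambda>_. 1 :: real)" by simp
  then show "integrable \<mu> f" using f0 by (subst (asm) integrable_real_density) auto
  have "(\<integral>x. 1 \<partial>density \<mu> (\<lambda>x. ennreal (f x))) = (1 :: real)" using prob_space by simp
  then show "(\<integral>x. f x \<partial>\<mu>) = 1" using f0 by (subst (asm) integral_real_density) auto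
qed

text \<open>Against \<mu> the integrand becomes -f ln f where f < 1, and -t ln t \<le> 1 - t. This
  rules out infinity minus infinity in \<open>rel_entropy\<close>.\<close>

lemma nn_integral_neg_ln_density_le_1:
  fixes f :: "'a \<Rightarrow> real"
  assumes "prob_space \<mu>" and [measurable]: "f \<in> borel_measurable \<mu>" and "\<And>x. 0 \<le> f x"
  shows "(\<integral>\<^sup>+ x. ennreal (max 0 (- ln (f x))) \<partial>density \<mu> (\<lambda>x. ennreal (f x))) \<le> 1"
proof -
  interpret prob_space \<mu> by fact
  have *: "t * max 0 (- ln t) \<le> 1" if "0 \<le> t" for t :: real
  proof (cases "t = 0")
    case False
    then have "- ln t \<le> 1 / t - 1" using that ln_le_minus_one[of "1/t"] by (simp add: ln_div)
    then have "t * (- ln t) \<le> t * (1 / t - 1)" using that by (intro mult_left_mono) auto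
    also have "\<dots> \<le> 1" using that False by (simp add: field_simps)
    finally show ?thesis by (simp add: max_def)
  qed simp
  have "(\<integral>\<^sup>+ x. ennreal (max 0 (- ln (f x))) \<partial>density \<mu> (\<lambda>x. ennreal (f x)))
      = (\<integral>\<^sup>+ x. ennreal (f x * max 0 (- ln (f x))) \<partial>\<mu>)"
    using assms(3) by (subst nn_integral_density) (auto simp: ennreal_mult)
  also have "\<dots> \<le> (\<integral>\<^sup>+ x. 1 \<partial>\<mu>)"
    using * assms(3) by (intro nn_integral_mono) (auto simp: ennreal_le_1)
  finally show ?thesis by (simp add: emeasure_space_1)
qed

lemma rel_entropy_eq:
  assumes "absolutely_continuous \<mu> \<nu>"
  shows "rel_entropy \<nu> \<mu> =
      enn2ereal (\<integral>\<^sup>+ x. ennreal (max 0 (ln (enn2real (RN_deriv \<mu> \<nu> x)))) \<partial>\<nu>)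
    - enn2ereal (\<integral>\<^sup>+ x. ennreal (max 0 (- ln (enn2real (RN_deriv \<mu> \<nu> x)))) \<partial>\<nu>)"
  using assms by (simp add: rel_entropy_def log_def)

text \<open>The negative part has integral at most 1, so an infinite positive part would make the
  entropy infinite. Hence both parts are finite and the split definition collapses to one Bochner
  integral.\<close>

lemma finite_rel_entropyE:
  assumes "prob_space \<mu>" "prob_space \<nu>" "sets \<nu> = sets \<mu>" "rel_entropy \<nu> \<mu> < \<infinity>"
  obtains f where "f \<in> borel_measurable \<mu>" "\<And>x. 0 \<le> f x" "\<nu> = density \<mu> (\<lambda>x. ennreal (f x))"
    "integrable \<mu> (\<lambda>x. f x * ln (f x))" "rel_entropy \<nu> \<mu> = ereal (\<integral>x. f x * ln (f x) \<partial>\<mu>)"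
proof
  let ?f = "\<lambda>x. enn2real (RN_deriv \<mu> \<nu> x)"
  let ?P = "\<integral>\<^sup>+ x. ennreal (max 0 (ln (?f x))) \<partial>\<nu>"
  let ?N = "\<integral>\<^sup>+ x. ennreal (max 0 (- ln (?f x))) \<partial>\<nu>"
  have ac: "absolutely_continuous \<mu> \<nu>" using assms(4) by (auto simp: rel_entropy_def split: if_splits)
  show d: "\<nu> = density \<mu> (\<lambda>x. ennreal (?f x))"
    using assms ac by (intro absolutely_continuous_density_real) auto
  have [measurable_cong]: "sets \<nu> = sets \<mu>" by fact
  show [measurable]: "?f \<in> borel_measurable \<mu>" "\<And>x. 0 \<le> ?f x" by auto
  have N: "?N \<le> 1"
    using nn_integral_neg_ln_density_le_1[OF assms(1), of ?f] d by auto
  then have N_fin: "?N < \<infinity>" by (auto simp: less_top intro: le_less_trans)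
  have "?P < \<infinity>"
  proof (rule ccontr)
    assume "\<not> ?P < \<infinity>"
    then have "?P = \<infinity>" by (metis infinity_ennreal_def less_top)
    then have "rel_entropy \<nu> \<mu> = \<infinity>" using N_fin unfolding rel_entropy_eq[OF ac] 
      by (cases ?N) (auto simp: enn2ereal_ennreal)
    then show False using assms(4) by simp
  qed
  have m: "ennreal (max 0 t) = ennreal t" for t :: real by (simp add: ennreal_max_0)
  have int: "integrable \<nu> (\<lambda>x. ln (?f x))"
    unfolding real_integrable_def using \<open>?P < \<infinity>\<close> N_fin unfolding m by (auto simp: less_top)
  show "integrable \<mu> (\<lambda>x. ?f x * ln (?f x))"
    using int by (subst (asm) d, subst (asm) integrable_real_density) auto
  have "rel_entropy \<nu> \<mu> = ereal (enn2real ?P - enn2real ?N)"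
    unfolding rel_entropy_eq[OF ac] using \<open>?P < \<infinity>\<close> N_fin
    by (cases ?P; cases ?N) (auto simp: enn2ereal_ennreal)
  also have "enn2real ?P - enn2real ?N = (\<integral>x. ln (?f x) \<partial>\<nu>)"
    unfolding m by (intro real_lebesgue_integral_def[symmetric] int)
  also have "\<dots> = (\<integral>x. ?f x * ln (?f x) \<partial>\<mu>)"
    by (subst d, subst integral_real_density) auto
  finally show "rel_entropy \<nu> \<mu> = ereal (\<integral>x. ?f x * ln (?f x) \<partial>\<mu>)" .
qed

text \<open>Young's inequality for the conjugate pair s ln s - s and exp u: it is 1 + x \<le> exp x
  at x = u - ln s, multiplied by s.\<close>

lemma mult_le_entropy_plus_exp:
  fixes s u :: real
  assumes "0 \<le> s"
  shows "s * u \<le> s * ln s - s + exp u"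
proof (cases "s = 0")
  case False
  then have s: "s > 0" using assms by simp
  have "1 + (u - ln s) \<le> exp (u - ln s)" by (rule exp_ge_add_one_self)
  also have "\<dots> = exp u / s" using s by (simp add: exp_diff)
  finally have "s * (1 + (u - ln s)) \<le> s * (exp u / s)" using s by (intro mult_left_mono) auto
  then show ?thesis using s by (simp add: algebra_simps)
qed simp

text \<open>Young's inequality is applied pointwise with s = f x and u = g x - ln Z; after
  integration -1 and Z / Z cancel. The test function may be unbounded above, so that
  \<open>h / b\<close> is admissible: its integrability under \<nu> comes from Young's upper bound
  together with the constant lower bound.\<close>

lemma donsker_varadhan:
  fixes g :: "'a \<Rightarrow> real"
  assumes "prob_space \<mu>" "prob_space \<nu>" "sets \<nu> = sets \<mu>" "rel_entropy \<nu> \<mu> \<le> ereal K"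
    and [measurable]: "g \<in> borel_measurable \<mu>" and B: "\<And>x. B \<le> g x"
    and exp: "integrable \<mu> (\<lambda>x. exp (g x))"
  shows "integrable \<nu> g" "(\<integral>x. g x \<partial>\<nu>) \<le> K + ln (\<integral>x. exp (g x) \<partial>\<mu>)"
proof -
  interpret M: prob_space \<mu> by fact
  interpret N: prob_space \<nu> by fact
  have "rel_entropy \<nu> \<mu> < \<infinity>" using assms(4) by (rule le_less_trans) simp
  then obtain f where f[measurable]: "f \<in> borel_measurable \<mu>" and f0: "\<And>x. 0 \<le> f x"
    and d: "\<nu> = density \<mu> (\<lambda>x. ennreal (f x))" and lnf: "integrable \<mu> (\<lambda>x. f x * ln (f x))"
    and H: "rel_entropy \<nu> \<mu> = ereal (\<integral>x. f x * ln (f x) \<partial>\<mu>)"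
    using assms by (elim finite_rel_entropyE[OF assms(1-3)]) blast+
  have fint: "integrable \<mu> f" and f1: "(\<integral>x. f x \<partial>\<mu>) = 1"
    using prob_density_integral[of f \<mu>] f0 d \<open>prob_space \<nu>\<close> by auto
  define Z where "Z = (\<integral>x. exp (g x) \<partial>\<mu>)"
  have "exp B \<le> Z" unfolding Z_def using B exp by (intro M.integral_ge_const) auto
  then have Z: "Z > 0" using exp_gt_zero[of B] by linarith
  have young: "f x * g x \<le> f x * ln (f x) - f x + exp (g x) / Z + f x * ln Z" for x
    using mult_le_entropy_plus_exp[OF f0[of x], of "g x - ln Z"] Z by (simp add: exp_diff algebra_simps)
  have rint: "integrable \<mu> (\<lambda>x. f x * ln (f x) - f x + exp (g x) / Z + f x * ln Z)"
    using lnf fint exp by auto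
  have fg: "integrable \<mu> (\<lambda>x. f x * g x)"
  proof (rule Bochner_Integration.integrable_bound)
    show "integrable \<mu> (\<lambda>x. \<bar>B\<bar> * f x + \<bar>f x * ln (f x) - f x + exp (g x) / Z + f x * ln Z\<bar>)"
      using rint fint by auto
    have "\<bar>f x * g x\<bar> \<le> \<bar>B\<bar> * f x + \<bar>f x * ln (f x) - f x + exp (g x) / Z + f x * ln Z\<bar>" for x
    proof -
      have "- (\<bar>B\<bar> * f x) \<le> B * f x"
        using mult_right_mono[of "-\<bar>B\<bar>" B "f x"] f0[of x] by simp
      also have "\<dots> \<le> f x * g x" using mult_left_mono[OF B f0, of x] by (simp add: mult.commute)
      finally show ?thesis using young[of x] mult_nonneg_nonneg[OF abs_ge_zero f0, of B x] by linarith
    qed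
    then show "AE x in \<mu>. norm (f x * g x)
      \<le> norm (\<bar>B\<bar> * f x + \<bar>f x * ln (f x) - f x + exp (g x) / Z + f x * ln Z\<bar>)"
      by (auto simp: abs_le_iff intro!: AE_I2 order_trans[OF _ abs_ge_self])
  qed measurable
  show "integrable \<nu> g" using fg f0 by (subst d, subst integrable_real_density) auto
  have "(\<integral>x. g x \<partial>\<nu>) = (\<integral>x. f x * g x \<partial>\<mu>)"
    using f0 by (subst d, subst integral_real_density) auto
  also have "\<dots> \<le> (\<integral>x. f x * ln (f x) - f x + exp (g x) / Z + f x * ln Z \<partial>\<mu>)"
    using young by (intro integral_mono fg rint)
  also have "\<dots> = (\<integral>x. f x * ln (f x) \<partial>\<mu>) - 1 + Z / Z + 1 * ln Z"
    using lnf fint exp by (simp add: f1 Z_def)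
  also have "\<dots> \<le> K + ln Z" using Z assms(4) unfolding H by simp
  finally show "(\<integral>x. g x \<partial>\<nu>) \<le> K + ln (\<integral>x. exp (g x) \<partial>\<mu>)" unfolding Z_def .
qed

text \<open>Multiples of indicators of \<mu>-null sets force absolute continuity, and truncations of
  the log density then recover the entropy in the limit. Only bounded test functions are involved,
  so entropy bounds can be passed through setwise limits with this criterion.\<close>

lemma rel_entropy_leI:
  assumes "prob_space \<mu>" "prob_space \<nu>" "sets \<nu> = sets \<mu>"
    and dv: "\<And>g B. g \<in> borel_measurable \<mu> \<Longrightarrow> (\<And>x. \<bar>g x\<bar> \<le> B) \<Longrightarrow>
      (\<integral>x. g x \<partial>\<nu>) \<le> K + ln (\<integral>x. exp (g x) \<partial>\<mu>)"
  shows "rel_entropy \<nu> \<mu> \<le> ereal K"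
proof -
  interpret M: prob_space \<mu> by fact
  interpret N: prob_space \<nu> by fact
  have [measurable_cong]: "sets \<nu> = sets \<mu>" by fact
  have ac: "absolutely_continuous \<mu> \<nu>"
    unfolding absolutely_continuous_def
  proof
    fix A assume A: "A \<in> null_sets \<mu>"
    then have [measurable]: "A \<in> sets \<mu>" by auto
    \<comment> \<open>A null set does not change the exponential integral, so the bound K is uniform
      in t.\<close>
    have le: "t * measure \<nu> A \<le> K" if "t \<ge> 0" for t
    proof -
      have "(\<integral>x. t * indicator A x \<partial>\<nu>) \<le> K + ln (\<integral>x. exp (t * indicator A x) \<partial>\<mu>)"
        using that by (intro dv[where B = t]) (auto simp: indicator_def)
      also have "(\<integral>x. exp (t * indicator A x) \<partial>\<mu>) = (\<integral>x. 1 \<partial>\<mu>)"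
        using A by (intro integral_cong_AE) (auto dest!: AE_not_in simp: indicator_def elim!: eventually_mono)
      finally show ?thesis by (simp add: M.prob_space)
    qed
    have "measure \<nu> A = 0"
    proof (rule ccontr)
      assume "measure \<nu> A \<noteq> 0"
      then have pos: "measure \<nu> A > 0" by (simp add: zero_less_measure_iff)
      then have "((\<bar>K\<bar> + 1) / measure \<nu> A) * measure \<nu> A \<le> K" by (intro le) auto
      then show False using pos by simp
    qed
    then show "A \<in> null_sets \<nu>" by (auto simp: null_sets_def N.emeasure_eq_measure)
  qed
  define f where "f = (\<lambda>x. enn2real (RN_deriv \<mu> \<nu> x))"
  have d: "\<nu> = density \<mu> (\<lambda>x. ennreal (f x))"
    unfolding f_def using assms ac by (intro absolutely_continuous_density_real) auto
  have f[measurable]: "f \<in> borel_measurable \<mu>" and f0: "\<And>x. 0 \<le> f x" unfolding f_def by auto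
  have fint: "integrable \<mu> f" and f1: "(\<integral>x. f x \<partial>\<mu>) = 1"
    using prob_density_integral[of f \<mu>] f0 d \<open>prob_space \<nu>\<close> by auto
  have fpos: "AE x in \<nu>. f x > 0"
    by (subst d, subst AE_density) (auto simp: ennreal_less_zero_iff)
  have N1: "(\<integral>\<^sup>+ x. ennreal (max 0 (- ln (f x))) \<partial>\<nu>) \<le> 1"
    using nn_integral_neg_ln_density_le_1[OF assms(1) f f0] d by simp
  have Nint: "integrable \<nu> (\<lambda>x. max 0 (- ln (f x)))"
    using le_less_trans[OF N1 ennreal_one_less_top] by (intro integrableI_nonneg) auto
  define N where "N = (\<integral>x. max 0 (- ln (f x)) \<partial>\<nu>)"
  have Neq: "(\<integral>\<^sup>+ x. ennreal (max 0 (- ln (f x))) \<partial>\<nu>) = ennreal N"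
    unfolding N_def by (intro nn_integral_eq_integral Nint) auto
  have N0: "0 \<le> N" unfolding N_def by (intro Bochner_Integration.integral_nonneg) auto
  define P where "P = (\<lambda>k::nat. \<integral>x. min (real k) (max 0 (ln (f x))) \<partial>\<nu>)"
  have Pint: "integrable \<nu> (\<lambda>x. min (real k) (max 0 (ln (f x))))" for k
    by (rule N.integrable_const_bound[where B = "real k"]) auto
  have Peq: "(\<integral>\<^sup>+ x. ennreal (min (real k) (max 0 (ln (f x)))) \<partial>\<nu>) = ennreal (P k)" for k
    unfolding P_def by (intro nn_integral_eq_integral Pint) auto
  have P0: "0 \<le> P k" for k unfolding P_def by (intro Bochner_Integration.integral_nonneg) auto
  have bound: "P k \<le> N + K + exp (- real k)" for k
  proof -
    \<comment> \<open>The truncated log density. Its value where f = 0 is set by hand, since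
      \<open>ln 0\<close> does not stand for minus infinity and exp(g) must be small there.\<close>
    define g where "g = (\<lambda>x. if f x = 0 then - real k else max (- real k) (min (real k) (ln (f x))))"
    have [measurable]: "g \<in> borel_measurable \<mu>" unfolding g_def by measurable
    have gb: "\<bar>g x\<bar> \<le> real k" for x unfolding g_def by auto
    have gint: "integrable \<nu> g" by (rule N.integrable_const_bound[where B = "real k"]) (auto simp: gb)
    have "P k - N = (\<integral>x. min (real k) (max 0 (ln (f x))) - max 0 (- ln (f x)) \<partial>\<nu>)"
      unfolding P_def N_def using Pint Nint by simp
    also have "\<dots> \<le> (\<integral>x. g x \<partial>\<nu>)"
    proof (intro integral_mono_AE gint Bochner_Integration.integrable_diff Pint Nint)
      show "AE x in \<nu>. min (real k) (max 0 (ln (f x))) - max 0 (- ln (f x)) \<le> g x"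
        using fpos by eventually_elim (auto simp: g_def)
    qed
    also have "\<dots> \<le> K + ln (\<integral>x. exp (g x) \<partial>\<mu>)" by (rule dv[OF _ gb]) simp
    also have "ln (\<integral>x. exp (g x) \<partial>\<mu>) \<le> exp (- real k)"
    proof -
      have eint: "integrable \<mu> (\<lambda>x. exp (g x))"
        by (rule M.integrable_const_bound[where B = "exp (real k)"]) (use gb in \<open>auto simp: abs_le_iff\<close>)
      have "exp (- real k) \<le> (\<integral>x. exp (g x) \<partial>\<mu>)"
        using gb by (intro M.integral_ge_const eint) (auto simp: abs_le_iff minus_le_iff)
      then have pos: "0 < (\<integral>x. exp (g x) \<partial>\<mu>)" using exp_gt_zero[of "- real k"] by linarith
      \<comment> \<open>Integrated against \<mu> this gives at most 1 + exp(-k), so the logarithm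
        costs at most exp(-k).\<close>
      have "exp (g x) \<le> f x + exp (- real k)" for x
      proof (cases "f x = 0")
        case False
        then have fx: "f x > 0" using f0[of x] by simp
        have "g x \<le> max (- real k) (ln (f x))" unfolding g_def using False by auto
        then have "exp (g x) \<le> exp (max (- real k) (ln (f x)))" by simp
        also have "\<dots> \<le> exp (ln (f x)) + exp (- real k)" by (auto simp: max_def)
        finally show ?thesis using fx by simp
      qed (simp add: g_def)
      then have "(\<integral>x. exp (g x) \<partial>\<mu>) \<le> (\<integral>x. f x + exp (- real k) \<partial>\<mu>)"
        using fint by (intro integral_mono eint) auto
      also have "\<dots> = 1 + exp (- real k)" using fint by (simp add: f1 M.prob_space)
      finally show ?thesis using ln_le_minus_one[OF pos] by linarith
    qed
    finally show ?thesis by simp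
  qed
  have lim: "(\<lambda>k. N + K + exp (- real k)) \<longlonglongrightarrow> N + K" by real_asymp
  \<comment> \<open>Nonnegativity keeps \<open>ennreal (N + K)\<close> from being truncated to 0
    when the bound is carried back to \<open>ereal\<close>.\<close>
  have NK: "0 \<le> N + K"
    using P0 bound by (intro LIMSEQ_le_const[OF lim]) (auto intro: order_trans)
  have "(\<lambda>k. \<integral>\<^sup>+ x. ennreal (min (real k) (max 0 (ln (f x)))) \<partial>\<nu>)
      \<longlonglongrightarrow> (\<integral>\<^sup>+ x. ennreal (max 0 (ln (f x))) \<partial>\<nu>)"
  proof (rule nn_integral_LIMSEQ)
    show "incseq (\<lambda>k x. ennreal (min (real k) (max 0 (ln (f x)))))"
      by (auto simp: incseq_def le_fun_def intro!: ennreal_leI)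
    fix x
    have "\<forall>\<^sub>F k in sequentially. max 0 (ln (f x)) \<le> real k" by real_asymp
    then have "\<forall>\<^sub>F k in sequentially. min (real k) (max 0 (ln (f x))) = max 0 (ln (f x))"
      by eventually_elim auto
    then show "(\<lambda>k. ennreal (min (real k) (max 0 (ln (f x))))) \<longlonglongrightarrow> ennreal (max 0 (ln (f x)))"
      by (intro tendsto_ennrealI tendsto_eventually)
  qed simp
  then have "(\<lambda>k. ennreal (P k)) \<longlonglongrightarrow> (\<integral>\<^sup>+ x. ennreal (max 0 (ln (f x))) \<partial>\<nu>)" unfolding Peq .
  then have Ple: "(\<integral>\<^sup>+ x. ennreal (max 0 (ln (f x))) \<partial>\<nu>) \<le> ennreal (N + K)"
    using bound by (intro LIMSEQ_le[OF _ tendsto_ennrealI[OF lim]]) (auto intro!: ennreal_leI)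
  have fx: "enn2real (RN_deriv \<mu> \<nu> x) = f x" for x by (simp add: f_def)
  have "rel_entropy \<nu> \<mu> = enn2ereal (\<integral>\<^sup>+ x. ennreal (max 0 (ln (f x))) \<partial>\<nu>) - ereal N"
    unfolding rel_entropy_eq[OF ac] fx Neq using N0 by (simp add: enn2ereal_ennreal)
  also have "\<dots> \<le> ereal (N + K) - ereal N"
    using Ple NK by (intro ereal_minus_mono) (auto simp: enn2ereal_ennreal less_eq_ennreal.rep_eq)
  finally show ?thesis by simp
qed

text \<open>The zero test function turns an entropy bound K into 0 \<le> K + ln 1.\<close>

lemma rel_entropy_nonneg:
  assumes "prob_space \<mu>" "prob_space \<nu>" "sets \<nu> = sets \<mu>"
  shows "0 \<le> rel_entropy \<nu> \<mu>"
proof (rule ccontr)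
  assume neg: "\<not> 0 \<le> rel_entropy \<nu> \<mu>"
  interpret M: prob_space \<mu> by fact
  obtain K where "rel_entropy \<nu> \<mu> \<le> ereal K" "K < 0"
    using neg ereal_dense2[of "rel_entropy \<nu> \<mu>" 0] by (auto simp: not_le dest: less_imp_le)
  with donsker_varadhan(2)[OF assms, of K "\<lambda>_. 0" 0] show False by (simp add: M.prob_space)
qed

text \<open>With K = 0 the variational criterion is Jensen's inequality, obtained from the tangent
  to exp at the mean of g. The lemma shows that the set of measures of finite entropy is
  nonempty.\<close>

lemma rel_entropy_self:
  assumes "prob_space \<mu>"
  shows "rel_entropy \<mu> \<mu> \<le> 0"
proof -
  interpret prob_space \<mu> by fact
  have "rel_entropy \<mu> \<mu> \<le> ereal 0"
  proof (rule rel_entropy_leI[OF assms assms refl])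
    fix g B assume [measurable]: "g \<in> borel_measurable \<mu>" and gb: "\<And>x. \<bar>g x\<bar> \<le> (B::real)"
    have gint: "integrable \<mu> g" by (rule integrable_const_bound[where B = B]) (auto simp: gb)
    have eint: "integrable \<mu> (\<lambda>x. exp (g x))"
      by (rule integrable_const_bound[where B = "exp B"]) (use gb in \<open>auto simp: abs_le_iff\<close>)
    define m where "m = (\<integral>x. g x \<partial>\<mu>)"
    have "exp m * (1 + (g x - m)) \<le> exp (g x)" for x
      using mult_left_mono[OF exp_ge_add_one_self[of "g x - m"], of "exp m"] by (simp add: exp_add[symmetric])
    then have "(\<integral>x. exp m * (1 + (g x - m)) \<partial>\<mu>) \<le> (\<integral>x. exp (g x) \<partial>\<mu>)"
      using gint by (intro integral_mono eint) auto
    then have "exp m \<le> (\<integral>x. exp (g x) \<partial>\<mu>)"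
      using gint by (simp add: m_def prob_space)
    then show "(\<integral>x. g x \<partial>\<mu>) \<le> 0 + ln (\<integral>x. exp (g x) \<partial>\<mu>)"
      unfolding m_def[symmetric] by (metis add_0 exp_gt_zero ln_exp ln_mono order_less_le_trans)
  qed
  then show ?thesis by (simp add: zero_ereal_def)
qed

section \<open>Setwise compactness\<close>

text \<open>The uniform tail estimate permits exchanging the limit in n with the infinite sum. It is
  used with a n i the masses of disjoint sets and s n the mass of their union.\<close>

lemma uniform_tail_limit:
  fixes s :: "nat \<Rightarrow> real" and a :: "nat \<Rightarrow> nat \<Rightarrow> real"
  assumes lim: "\<And>i. (\<lambda>n. a n i) \<longlonglongrightarrow> l i"
    and tail: "\<And>e. e > 0 \<Longrightarrow> \<exists>m0. \<forall>m\<ge>m0. \<forall>n. \<bar>s n - (\<Sum>i<m. a n i)\<bar> \<le> e"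
  obtains S where "s \<longlonglongrightarrow> S" "l sums S"
proof -
  have "Cauchy s"
  proof (rule CauchyI)
    fix e :: real assume e: "e > 0"
    then obtain m where m: "\<And>n. \<bar>s n - (\<Sum>i<m. a n i)\<bar> \<le> e / 4" using tail[of "e/4"] by auto
    have "Cauchy (\<lambda>n. \<Sum>i<m. a n i)"
      using lim by (intro LIMSEQ_imp_Cauchy[of _ "\<Sum>i<m. l i"] tendsto_sum) auto
    then obtain M where M: "\<And>k n. M \<le> k \<Longrightarrow> M \<le> n \<Longrightarrow> norm ((\<Sum>i<m. a k i) - (\<Sum>i<m. a n i)) < e / 4"
      using CauchyD[of _ "e/4"] e by fastforce
    have "norm (s k - s n) < e" if "M \<le> k" "M \<le> n" for k n
      using M[OF that] m[of k] m[of n] e by (simp add: abs_if split: if_splits)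
    then show "\<exists>M. \<forall>m\<ge>M. \<forall>n\<ge>M. norm (s m - s n) < e" by blast
  qed
  then obtain S where S: "s \<longlonglongrightarrow> S" by (auto simp: Cauchy_convergent_iff convergent_def)
  have "l sums S" unfolding sums_def
  proof (rule LIMSEQ_I)
    fix e :: real assume e: "e > 0"
    then obtain m0 where m0: "\<And>m n. m \<ge> m0 \<Longrightarrow> \<bar>s n - (\<Sum>i<m. a n i)\<bar> \<le> e / 2"
      using tail[of "e/2"] by auto
    have "norm ((\<Sum>i<m. l i) - S) < e" if "m \<ge> m0" for m
    proof -
      have "(\<lambda>n. \<bar>s n - (\<Sum>i<m. a n i)\<bar>) \<longlonglongrightarrow> \<bar>S - (\<Sum>i<m. l i)\<bar>"
        using S lim by (intro tendsto_intros) auto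
      then have "\<bar>S - (\<Sum>i<m. l i)\<bar> \<le> e / 2" using m0[OF that] by (intro LIMSEQ_le_const2) auto
      then show ?thesis using e by (simp add: abs_minus_commute)
    qed
    then show "\<exists>no. \<forall>n\<ge>no. norm (sum l {..<n} - S) < e" by blast
  qed
  with S show thesis by (rule that)
qed

lemma (in finite_measure) measure_UN_tail:
  fixes A :: "nat \<Rightarrow> 'a set"
  assumes A: "range A \<subseteq> sets M" "disjoint_family A"
  shows "measure M ((\<Union>i. A i) - (\<Union>i<m. A i)) = measure M (\<Union>i. A i) - (\<Sum>i<m. measure M (A i))"
proof -
  have "measure M (\<Union>i<m. A i) = (\<Sum>i<m. measure M (A i))"
    using A by (intro finite_measure_finite_Union) (auto simp: disjoint_family_on_def)
  then show ?thesis using A by (subst finite_measure_Diff) auto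
qed

text \<open>Finite intersections of a countable basis. Countability serves the diagonal extraction,
  stability under intersection the Dynkin induction.\<close>

lemma countable_Int_stable_generator_borel:
  obtains G :: "'a::second_countable_topology set set"
  where "countable G" "Int_stable G" "sets (borel :: 'a measure) = sigma_sets UNIV G"
proof -
  obtain B :: "'a set set" where B: "countable B" "topological_basis B"
    using ex_countable_basis by blast
  define G where "G = Inter ` {F. finite F \<and> F \<subseteq> B}"
  show thesis
  proof
    show "countable G" unfolding G_def using B by (intro countable_image countable_Collect_finite_subset)
    show "Int_stable G"
    proof (rule Int_stableI)
      fix a b assume "a \<in> G" "b \<in> G"
      then obtain F F' where "finite F" "F \<subseteq> B" "a = \<Inter>F" "finite F'" "F' \<subseteq> B" "b = \<Inter>F'"
        unfolding G_def by auto
      then show "a \<inter> b \<in> G" unfolding G_def by (intro image_eqI[of _ _ "F \<union> F'"]) auto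
    qed
    have "G \<subseteq> sets borel"
      unfolding G_def using B by (auto intro!: borel_open open_Inter dest: topological_basis_open)
    then have "sigma_sets UNIV G \<subseteq> sets borel" by (metis sets.sigma_sets_subset space_borel)
    moreover have "B \<subseteq> G"
    proof
      fix b assume "b \<in> B"
      then show "b \<in> G" unfolding G_def by (intro image_eqI[of _ _ "{b}"]) auto
    qed
    then have "sigma_sets UNIV B \<subseteq> sigma_sets UNIV G" by (rule sigma_sets_mono')
    moreover have "sets (borel :: 'a measure) = sigma_sets UNIV B"
      by (subst borel_eq_countable_basis[OF B]) simp
    ultimately show "sets (borel :: 'a measure) = sigma_sets UNIV G" by auto
  qed
qed

text \<open>Bolzano--Weierstrass for each set of G in turn, followed by the diagonal
  subsequence.\<close>

lemma convergent_subseq_on_countable: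
  fixes N :: "nat \<Rightarrow> 'a set \<Rightarrow> real"
  assumes "countable G" and bound: "\<And>n A. \<bar>N n A\<bar> \<le> B"
  obtains r where "strict_mono (r :: nat \<Rightarrow> nat)" "\<And>A. A \<in> G \<Longrightarrow> convergent (\<lambda>n. N (r n) A)"
proof -
  define e where "e = from_nat_into (insert {} G)"
  interpret subseqs "\<lambda>i s. convergent (\<lambda>n. N (s n) (e i))"
  proof
    fix i and s :: "nat \<Rightarrow> nat"
    have "bounded (range (\<lambda>n. N (s n) (e i)))"
      using bound by (intro boundedI[of _ B]) auto
    from bounded_imp_convergent_subsequence[OF this]
    show "\<exists>r'. strict_mono r' \<and> convergent (\<lambda>n. N ((s \<circ> r') n) (e i))"
      by (auto simp: convergent_def o_def)
  qed
  show thesis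
  proof
    show "strict_mono diagseq" by (rule subseq_diagseq)
    fix A assume "A \<in> G"
    then obtain i where i: "e i = A"
      unfolding e_def using assms(1) by (metis countable_insert from_nat_into_to_nat_on insertCI)
    have "convergent (\<lambda>n. N ((diagseq \<circ> (+) (Suc i)) n) (e i))"
    proof (rule diagseq_holds)
      fix i and s r :: "nat \<Rightarrow> nat" assume "strict_mono r" "convergent (\<lambda>n. N (s n) (e i))"
      then show "convergent (\<lambda>n. N ((s \<circ> r) n) (e i))"
        using convergent_subseq_convergent[of "\<lambda>n. N (s n) (e i)" r] by (simp add: o_def)
    qed
    then have "convergent (\<lambda>n. N (diagseq (n + Suc i)) A)" by (simp add: o_def i add.commute)
    then show "convergent (\<lambda>n. N (diagseq n) A)" by (subst (asm) convergent_ignore_initial_segment)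
  qed
qed

text \<open>Diagonal extraction gives convergence on a countable generator, and Dynkin induction
  carries it to all Borel sets. Setwise limits of measures are then assembled into a measure, with
  total mass 1 because the whole space is one of the sets.\<close>

lemma setwise_sequentially_compact:
  fixes \<mu> :: "'a::second_countable_topology measure" and N :: "nat \<Rightarrow> 'a measure"
  assumes mu: "\<mu> \<in> prob_measures" and N: "\<And>n. N n \<in> prob_measures"
    and uac: "\<And>e. e > 0 \<Longrightarrow>
      \<exists>d>0. \<forall>n. \<forall>A\<in>sets borel. measure \<mu> A < d \<longrightarrow> measure (N n) A < e"
  obtains r L where "strict_mono (r :: nat \<Rightarrow> nat)" "L \<in> prob_measures"
    "\<And>A. A \<in> sets borel \<Longrightarrow> (\<lambda>n. measure (N (r n)) A) \<longlonglongrightarrow> measure L A"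
proof -
  have smu[simp]: "sets \<mu> = sets borel" and "prob_space \<mu>" using mu by (auto simp: prob_measures_def)
  interpret M: prob_space \<mu> by fact
  have sN[simp]: "sets (N n) = sets borel" and pN: "prob_space (N n)" for n
    using N by (auto simp: prob_measures_def)
  have spN[simp]: "space (N n) = UNIV" for n using sets_eq_imp_space_eq[OF sN[of n]] by simp
  obtain G :: "'a set set" where G: "countable G" "Int_stable G"
    and borel: "sets (borel :: 'a measure) = sigma_sets UNIV G"
    by (rule countable_Int_stable_generator_borel)
  have "\<bar>measure (N n) A\<bar> \<le> 1" for n A
    using prob_space.prob_le_1[OF pN] by simp
  then obtain r where r: "strict_mono (r :: nat \<Rightarrow> nat)"
    and rG: "\<And>A. A \<in> G \<Longrightarrow> convergent (\<lambda>n. measure (N (r n)) A)"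
    using convergent_subseq_on_countable[OF G(1), of "\<lambda>n. measure (N n)" 1] by metis
  define L where "L = (\<lambda>A. lim (\<lambda>n. measure (N (r n)) A))"
  \<comment> \<open>Uniform absolute continuity makes the tails of a disjoint union small for all n
    at once. This serves twice: for convergence on disjoint unions and for countable additivity of
    the limit.\<close>
  have tail: "\<exists>m0. \<forall>m\<ge>m0. \<forall>n. \<bar>measure (N (r n)) (\<Union>i. A i) - (\<Sum>i<m. measure (N (r n)) (A i))\<bar> \<le> e"
    if A: "range A \<subseteq> sets borel" "disjoint_family A" and e: "e > 0" for A :: "nat \<Rightarrow> 'a set" and e
  proof -
    obtain d where d: "d > 0"
      "\<And>n B. B \<in> sets borel \<Longrightarrow> measure \<mu> B < d \<Longrightarrow> measure (N n) B < e" using uac[OF e] by blast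
    have "(\<lambda>i. measure \<mu> (A i)) sums measure \<mu> (\<Union>i. A i)"
      using A by (intro M.finite_measure_UNION) auto
    then obtain m0 where m0: "\<And>m. m \<ge> m0 \<Longrightarrow> norm ((\<Sum>i<m. measure \<mu> (A i)) - measure \<mu> (\<Union>i. A i)) < d"
      unfolding sums_def using LIMSEQ_D[OF _ d(1)] by blast
    have "\<bar>measure (N k) (\<Union>i. A i) - (\<Sum>i<m. measure (N k) (A i))\<bar> \<le> e" if m: "m \<ge> m0" for m k
    proof -
      interpret K: prob_space "N k" by (rule pN)
      let ?T = "(\<Union>i. A i) - (\<Union>i<m. A i)"
      have "measure \<mu> ?T < d" using m0[OF m] M.measure_UN_tail[of A m] A by (simp add: abs_if split: if_splits)
      then have "measure (N k) ?T < e" using A by (intro d(2)) auto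
      moreover have "measure (N k) ?T = measure (N k) (\<Union>i. A i) - (\<Sum>i<m. measure (N k) (A i))"
        using A by (intro K.measure_UN_tail) auto
      moreover have "0 \<le> measure (N k) ?T" by simp
      ultimately show ?thesis by linarith
    qed
    then show ?thesis by blast
  qed
  have conv: "convergent (\<lambda>n. measure (N (r n)) A)" if "A \<in> sets borel" for A
  proof -
    have "G \<subseteq> Pow UNIV" by simp
    with G(2) show ?thesis using that[unfolded borel]
    proof (induction A rule: sigma_sets_induct_disjoint)
      case (basic A)
      then show ?case by (rule rG)
    next
      case empty
      then show ?case by (simp add: convergent_const)
    next
      case (compl A)
      have "measure (N (r n)) (UNIV - A) = 1 - measure (N (r n)) A" for n
        using prob_space.prob_compl[OF pN, of A "r n"] compl(1) by (simp add: borel)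
      then show ?case using compl(2) by (auto intro!: convergent_diff convergent_const)
    next
      case (union A)
      have "(\<lambda>n. measure (N (r n)) (A i)) \<longlonglongrightarrow> L (A i)" for i
        using union(3) unfolding L_def by (simp add: convergent_LIMSEQ_iff)
      then show ?case
        using union by (elim uniform_tail_limit[OF _ tail]) (auto simp: borel convergent_def)
    qed
  qed
  then have lim: "(\<lambda>n. measure (N (r n)) A) \<longlonglongrightarrow> L A" if "A \<in> sets borel" for A
    using that unfolding L_def by (simp add: convergent_LIMSEQ_iff)
  have L0: "0 \<le> L A" if "A \<in> sets borel" for A
    using lim[OF that] by (rule LIMSEQ_le_const) auto
  define \<nu> :: "'a measure" where "\<nu> = measure_of UNIV (sets borel) (\<lambda>A. ennreal (L A))"
  have sets_nu: "sets \<nu> = sets borel"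
    unfolding \<nu>_def by (metis sets.sets_measure_of_eq space_borel)
  have em: "emeasure \<nu> A = ennreal (L A)" if "A \<in> sets borel" for A
  proof (rule emeasure_measure_of[OF \<nu>_def])
    show "positive (sets \<nu>) (\<lambda>A. ennreal (L A))"
      using lim[of "{}"] by (auto simp: positive_def LIMSEQ_const_iff)
    show "countably_additive (sets \<nu>) (\<lambda>A. ennreal (L A))"
    proof (rule countably_additiveI)
      fix A :: "nat \<Rightarrow> 'a set" assume A: "range A \<subseteq> sets \<nu>" "disjoint_family A" "(\<Union>i. A i) \<in> sets \<nu>"
      then have A': "\<And>i. A i \<in> sets borel" "range A \<subseteq> sets borel" by (auto simp: sets_nu)
      obtain S where S: "(\<lambda>n. measure (N (r n)) (\<Union>i. A i)) \<longlonglongrightarrow> S" "(\<lambda>i. L (A i)) sums S"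
        using uniform_tail_limit[OF lim[OF A'(1)] tail[OF A'(2) A(2)]] by metis
      have "S = L (\<Union>i. A i)" using LIMSEQ_unique[OF S(1) lim] A by (auto simp: sets_nu)
      then show "(\<Sum>i. ennreal (L (A i))) = ennreal (L (\<Union>i. A i))"
        using S(2) L0[OF A'(1)] by (auto simp: sums_iff suminf_ennreal2)
    qed
  qed (use that in \<open>auto simp: sets_nu\<close>)
  have "L UNIV = 1"
  proof (rule LIMSEQ_unique[OF lim])
    show "(\<lambda>n. measure (N (r n)) UNIV) \<longlonglongrightarrow> 1" using prob_space.prob_space[OF pN] by simp
  qed simp
  then have "prob_space \<nu>"
    using em[of UNIV] sets_eq_imp_space_eq[OF sets_nu] by (intro prob_spaceI) simp
  then have "\<nu> \<in> prob_measures" using sets_nu by (simp add: prob_measures_def)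
  moreover have "(\<lambda>n. measure (N (r n)) A) \<longlonglongrightarrow> measure \<nu> A" if "A \<in> sets borel" for A
    using lim[OF that] em[OF that] L0[OF that] by (simp add: measure_def)
  ultimately show thesis using r that by blast
qed

text \<open>Pushed forward to the real line along g, setwise convergence gives convergence of the
  distribution functions at every point, hence weak convergence. The clamp to [-B, B] is a bounded
  continuous function that is the identity on the range of g.\<close>

lemma setwise_integral_tendsto:
  fixes g :: "'a \<Rightarrow> real"
  assumes "\<And>n. prob_space (N n)" "prob_space L" "\<And>n. sets (N n) = sets S" "sets L = sets S"
    and conv: "\<And>A. A \<in> sets S \<Longrightarrow> (\<lambda>n. measure (N n) A) \<longlonglongrightarrow> measure L A"
    and [measurable]: "g \<in> borel_measurable S" and B: "\<And>x. \<bar>g x\<bar> \<le> B"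
  shows "(\<lambda>n. \<integral>x. g x \<partial>N n) \<longlonglongrightarrow> (\<integral>x. g x \<partial>L)"
proof -
  have [measurable_cong]: "\<And>n. sets (N n) = sets S" "sets L = sets S" by fact+
  have sp: "space (N n) = space S" "space L = space S" for n
    using assms by (auto intro!: sets_eq_imp_space_eq)
  have "(\<lambda>n. \<integral>y. max (- B) (min B y) \<partial>distr (N n) borel g) \<longlonglongrightarrow> (\<integral>y. max (- B) (min B y) \<partial>distr L borel g)"
  proof (rule weak_conv_imp_integral_bdd_continuous_conv)
    show "real_distribution (distr (N n) borel g)" for n
      by (intro prob_space.real_distribution_distr assms) measurable
    show "real_distribution (distr L borel g)"
      by (intro prob_space.real_distribution_distr assms) measurable
    show "weak_conv_m (\<lambda>n. distr (N n) borel g) (distr L borel g)"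
      unfolding weak_conv_m_def weak_conv_def cdf_def
    proof (intro allI impI)
      fix x
      have "{y \<in> space S. g y \<le> x} \<in> sets S" by measurable
      from conv[OF this]
      show "(\<lambda>n. measure (distr (N n) borel g) {..x}) \<longlonglongrightarrow> measure (distr L borel g) {..x}"
        by (simp add: measure_distr sp vimage_def Int_def conj_commute)
    qed
    show "isCont (\<lambda>y. max (- B) (min B y)) x" for x by (intro continuous_intros)
    show "norm (max (- B) (min B y)) \<le> \<bar>B\<bar>" for y :: real by (auto simp: max_def min_def)
  qed
  moreover have "max (- B) (min B (g x)) = g x" for x using B[of x] by (auto simp: abs_le_iff)
  ultimately show ?thesis by (simp add: integral_distr)
qed

section \<open>Gluing couplings through countable partitions\<close>

lemma couplingsD:
  assumes "\<pi> \<in> couplings \<nu> \<mu>"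
  shows "prob_space \<pi>" "sets \<pi> = sets (borel \<Otimes>\<^sub>M borel)" "distr \<pi> borel fst = \<nu>" "distr \<pi> borel snd = \<mu>"
  using assms by (auto simp: couplings_def)

lemma product_in_couplings:
  assumes "\<nu> \<in> prob_measures" "\<mu> \<in> prob_measures"
  shows "\<nu> \<Otimes>\<^sub>M \<mu> \<in> couplings \<nu> \<mu>"
proof -
  have s: "sets \<nu> = sets borel" "sets \<mu> = sets borel" and "prob_space \<nu>" "prob_space \<mu>"
    using assms by (auto simp: prob_measures_def)
  interpret N: prob_space \<nu> by fact
  interpret M: prob_space \<mu> by fact
  interpret P: pair_prob_space \<nu> \<mu> ..
  have "distr (\<nu> \<Otimes>\<^sub>M \<mu>) borel fst = distr (\<nu> \<Otimes>\<^sub>M \<mu>) \<nu> fst"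
    using s by (intro distr_cong) auto
  also have "\<dots> = \<nu>" using M.emeasure_space_1 by (simp add: M.distr_pair_fst)
  finally have 1: "distr (\<nu> \<Otimes>\<^sub>M \<mu>) borel fst = \<nu>" .
  have "distr (\<nu> \<Otimes>\<^sub>M \<mu>) borel snd = distr (\<nu> \<Otimes>\<^sub>M \<mu>) \<mu> snd"
    using s by (intro distr_cong) auto
  also have "\<dots> = distr (distr (\<mu> \<Otimes>\<^sub>M \<nu>) (\<nu> \<Otimes>\<^sub>M \<mu>) (\<lambda>(x, y). (y, x))) \<mu> snd"
    by (subst P.distr_pair_swap) simp
  also have "\<dots> = distr (\<mu> \<Otimes>\<^sub>M \<nu>) \<mu> fst"
    by (subst distr_distr) (auto simp: o_def split_beta intro!: distr_cong)
  also have "\<dots> = \<mu>" using N.emeasure_space_1 by (simp add: N.distr_pair_fst)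
  finally have 2: "distr (\<nu> \<Otimes>\<^sub>M \<mu>) borel snd = \<mu>" .
  have "sets (\<nu> \<Otimes>\<^sub>M \<mu>) = sets (borel \<Otimes>\<^sub>M borel)" using s by (intro sets_pair_measure_cong)
  with 1 2 P.prob_space_axioms show ?thesis by (simp add: couplings_def)
qed

lemma emeasure_distr_eq_nn_integral:
  assumes [measurable]: "f \<in> measurable M N" "A \<in> sets N"
  shows "emeasure (distr M N f) A = (\<integral>\<^sup>+ x. indicator A (f x) \<partial>M)"
  using nn_integral_distr[of f M N "indicator A"] by simp

text \<open>Gluing along a middle marginal usually needs disintegration. Here the coupling of
  \<open>\<nu>'\<close> with the first marginal of \<open>\<pi>\<close> has a density \<open>G\<close>, so \<open>\<nu>' \<Otimes>\<^sub>M \<pi>\<close> reweighted by \<open>G\<close>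
  is already the glued measure.\<close>
lemma transport_cost_glue:
  fixes \<nu>' :: "'a::topological_space measure"
  assumes nu': "\<nu>' \<in> prob_measures" and pi: "\<pi> \<in> couplings \<nu> \<mu>"
    and G[measurable]: "(\<lambda>w. G (fst w) (snd w)) \<in> borel_measurable (borel \<Otimes>\<^sub>M borel)"
    and c[measurable]: "(\<lambda>z. ennreal (c (fst z) (snd z))) \<in> borel_measurable (borel \<Otimes>\<^sub>M borel)"
    and m1: "AE x in \<nu>'. (\<integral>\<^sup>+ z. G x (fst z) \<partial>\<pi>) = (1::ennreal)"
    and m2: "AE z in \<pi>. (\<integral>\<^sup>+ x. G x (fst z) \<partial>\<nu>') = (1::ennreal)"
  shows "transport_cost c \<nu>' \<mu> \<le> (\<integral>\<^sup>+ x. \<integral>\<^sup>+ z. G x (fst z) * ennreal (c x (snd z)) \<partial>\<pi> \<partial>\<nu>')"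
proof -
  have s[measurable_cong]: "sets \<nu>' = sets borel" "sets \<pi> = sets (borel \<Otimes>\<^sub>M borel)"
    and "prob_space \<nu>'" "prob_space \<pi>"
    using nu' couplingsD[OF pi] by (auto simp: prob_measures_def)
  interpret N: prob_space \<nu>' by fact
  interpret Q: prob_space \<pi> by fact
  interpret NQ: pair_sigma_finite \<nu>' \<pi> ..
  have G'[measurable]: "(\<lambda>w. G (fst w) (fst (snd w))) \<in> borel_measurable (\<nu>' \<Otimes>\<^sub>M \<pi>)"
    using measurable_compose[of "\<lambda>w. (fst w, fst (snd w))" "\<nu>' \<Otimes>\<^sub>M \<pi>" _ _ _, OF _ G] by simp
  define \<gamma> where "\<gamma> = distr (density (\<nu>' \<Otimes>\<^sub>M \<pi>) (\<lambda>w. G (fst w) (fst (snd w))))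
      (borel \<Otimes>\<^sub>M borel) (\<lambda>w. (fst w, snd (snd w)))"
  have sets_g[measurable_cong]: "sets \<gamma> = sets (borel \<Otimes>\<^sub>M borel)" by (simp add: \<gamma>_def)
  have g: "(\<integral>\<^sup>+ w. F w \<partial>\<gamma>) = (\<integral>\<^sup>+ w. G (fst w) (fst (snd w)) * F (fst w, snd (snd w)) \<partial>(\<nu>' \<Otimes>\<^sub>M \<pi>))"
    if [measurable]: "F \<in> borel_measurable (borel \<Otimes>\<^sub>M borel)" for F
    unfolding \<gamma>_def by (simp add: nn_integral_distr nn_integral_density)
  \<comment> \<open>The two orders of integration serve the two marginals: with z innermost the
    first one follows from \<open>m1\<close>, with x innermost the second one follows from
    \<open>m2\<close>.\<close>
  have g1: "(\<integral>\<^sup>+ w. F w \<partial>\<gamma>) = (\<integral>\<^sup>+ x. \<integral>\<^sup>+ z. G x (fst z) * F (x, snd z) \<partial>\<pi> \<partial>\<nu>')"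
    if [measurable]: "F \<in> borel_measurable (borel \<Otimes>\<^sub>M borel)" for F
    unfolding g[OF that] by (subst Q.nn_integral_fst[symmetric]) auto
  have g2: "(\<integral>\<^sup>+ w. F w \<partial>\<gamma>) = (\<integral>\<^sup>+ z. \<integral>\<^sup>+ x. G x (fst z) * F (x, snd z) \<partial>\<nu>' \<partial>\<pi>)"
    if [measurable]: "F \<in> borel_measurable (borel \<Otimes>\<^sub>M borel)" for F
    unfolding g[OF that] by (subst NQ.nn_integral_snd[symmetric]) auto
  have Gx[measurable]: "(\<lambda>z. G x (fst z)) \<in> borel_measurable \<pi>" for x
    using measurable_compose[of "\<lambda>z. (x, fst z)" "\<pi>" _ _ _, OF _ G] by simp
  have Gz[measurable]: "(\<lambda>x. G x y) \<in> borel_measurable \<nu>'" for y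
    using measurable_compose[of "\<lambda>x. (x, y)" "\<nu>'" _ _ _, OF _ G] by simp
  have d1: "distr \<gamma> borel fst = \<nu>'"
  proof (rule measure_eqI)
    fix A assume "A \<in> sets (distr \<gamma> borel fst)"
    then have A[measurable]: "A \<in> sets borel" by simp
    have "emeasure (distr \<gamma> borel fst) A = (\<integral>\<^sup>+ w. indicator A (fst w) \<partial>\<gamma>)"
      by (intro emeasure_distr_eq_nn_integral) measurable
    also have "\<dots> = (\<integral>\<^sup>+ x. \<integral>\<^sup>+ z. G x (fst z) * indicator A x \<partial>\<pi> \<partial>\<nu>')"
      by (subst g1) auto
    also have "\<dots> = (\<integral>\<^sup>+ x. (\<integral>\<^sup>+ z. G x (fst z) \<partial>\<pi>) * indicator A x \<partial>\<nu>')"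
      by (simp add: nn_integral_multc)
    also have "\<dots> = (\<integral>\<^sup>+ x. indicator A x \<partial>\<nu>')"
      using m1 by (intro nn_integral_cong_AE) auto
    finally show "emeasure (distr \<gamma> borel fst) A = emeasure \<nu>' A" by simp
  qed (simp add: s)
  have d2: "distr \<gamma> borel snd = \<mu>"
  proof -
    have "distr \<gamma> borel snd = distr \<pi> borel snd"
    proof (rule measure_eqI)
      fix A assume "A \<in> sets (distr \<gamma> borel snd)"
      then have A[measurable]: "A \<in> sets borel" by simp
      have "emeasure (distr \<gamma> borel snd) A = (\<integral>\<^sup>+ w. indicator A (snd w) \<partial>\<gamma>)"
        by (intro emeasure_distr_eq_nn_integral) measurable
      also have "\<dots> = (\<integral>\<^sup>+ z. \<integral>\<^sup>+ x. G x (fst z) * indicator A (snd z) \<partial>\<nu>' \<partial>\<pi>)"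
        by (subst g2) auto
      also have "\<dots> = (\<integral>\<^sup>+ z. (\<integral>\<^sup>+ x. G x (fst z) \<partial>\<nu>') * indicator A (snd z) \<partial>\<pi>)"
        by (simp add: nn_integral_multc)
      also have "\<dots> = (\<integral>\<^sup>+ z. indicator A (snd z) \<partial>\<pi>)"
        using m2 by (intro nn_integral_cong_AE) auto
      also have "\<dots> = emeasure (distr \<pi> borel snd) A"
        by (intro emeasure_distr_eq_nn_integral[symmetric]) measurable
      finally show "emeasure (distr \<gamma> borel snd) A = emeasure (distr \<pi> borel snd) A" .
    qed simp
    then show ?thesis using couplingsD[OF pi] by simp
  qed
  have "prob_space \<gamma>"
  proof (rule prob_space_distrD[where f = fst and N = borel])
    show "prob_space (distr \<gamma> borel fst)" using \<open>prob_space \<nu>'\<close> by (simp add: d1)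
  qed measurable
  then have "\<gamma> \<in> couplings \<nu>' \<mu>" using d1 d2 sets_g by (simp add: couplings_def)
  then have "transport_cost c \<nu>' \<mu> \<le> (\<integral>\<^sup>+ w. ennreal (c (fst w) (snd w)) \<partial>\<gamma>)"
    unfolding transport_cost_def by (rule INF_lower)
  also have "\<dots> = (\<integral>\<^sup>+ x. \<integral>\<^sup>+ z. G x (fst z) * ennreal (c x (snd z)) \<partial>\<pi> \<partial>\<nu>')"
    by (subst g1) auto
  finally show ?thesis .
qed


text \<open>Within each cell as much mass as possible, the minimum of the two cell masses, is moved
  from \<nu>' to \<nu> at small cost; the leftovers are matched by a product. Gluing with \<pi>
  charges the local part by the cost of \<pi> and the rest by h. The level M splits h on the
  leftover of \<nu>' into a bounded part times the leftover mass and a tail.\<close>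

lemma transport_cost_cell_bound:
  fixes \<nu> \<nu>' \<mu> :: "'a::topological_space measure" and k :: "'a \<Rightarrow> nat" and c :: "'a \<Rightarrow> 'a \<Rightarrow> real"
  assumes nu': "\<nu>' \<in> prob_measures" and nu: "\<nu> \<in> prob_measures" and pi: "\<pi> \<in> couplings \<nu> \<mu>"
    and k[measurable]: "k \<in> measurable borel (count_space UNIV)"
    and c[measurable]: "(\<lambda>z. c (fst z) (snd z)) \<in> borel_measurable (borel \<Otimes>\<^sub>M borel)"
    and h[measurable]: "h \<in> borel_measurable borel"
    and pos: "0 \<le> A" "0 \<le> C" "0 \<le> D" "0 \<le> M" "\<And>x y. 0 \<le> c x y" "\<And>x. 0 \<le> h x"
    and near: "\<And>x x' y. k x' = k x \<Longrightarrow> c x' y \<le> A * c x y + D"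
    and far: "\<And>x y. c x y \<le> A * h x + C * h y"
  defines "v \<equiv> \<lambda>x. measure \<nu>' (k -` {k x}) / max (measure \<nu>' (k -` {k x})) (measure \<nu> (k -` {k x}))"
  shows "transport_cost c \<nu>' \<mu> \<le>
      ennreal A * (\<integral>\<^sup>+ z. ennreal (c (fst z) (snd z)) \<partial>\<pi>) + ennreal D
      + ennreal A * (ennreal M * (\<integral>\<^sup>+ z. ennreal (1 - v (fst z)) \<partial>\<pi>)
          + (\<integral>\<^sup>+ x. ennreal (h x * indicator {x. M < h x} x) \<partial>\<nu>'))
      + ennreal C * (\<integral>\<^sup>+ z. ennreal ((1 - v (fst z)) * h (snd z)) \<partial>\<pi>)"
proof -
  have s[measurable_cong]: "sets \<nu>' = sets borel" "sets \<nu> = sets borel" "sets \<pi> = sets (borel \<Otimes>\<^sub>M borel)"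
    and "prob_space \<nu>'" "prob_space \<nu>" "prob_space \<pi>"
    using nu' nu couplingsD[OF pi] by (auto simp: prob_measures_def)
  interpret N': prob_space \<nu>' by fact
  interpret N: prob_space \<nu> by fact
  interpret Q: prob_space \<pi> by fact
  interpret NQ: pair_sigma_finite \<nu>' \<pi> ..
  define p q where "p = (\<lambda>i. measure \<nu>' (k -` {i}))" and "q = (\<lambda>i. measure \<nu> (k -` {i}))"
  define m where "m = (\<lambda>i. max (p i) (q i))"
  define u where "u = (\<lambda>x. q (k x) / m (k x))"
  have v: "v = (\<lambda>x. p (k x) / m (k x))" by (simp add: v_def p_def q_def m_def)
  have m0: "0 \<le> p i" "0 \<le> q i" "p i \<le> m i" "q i \<le> m i" "0 \<le> m i" for i
    by (auto simp: p_def q_def m_def intro: max.coboundedI1)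
  have u01: "0 \<le> u x" "u x \<le> 1" and v01: "0 \<le> v x" "v x \<le> 1" for x
    using m0[of "k x"] by (auto simp: u_def v divide_le_eq_1)
  have [measurable]: "(\<lambda>i. p i) \<in> borel_measurable (count_space UNIV)"
    "(\<lambda>i. q i) \<in> borel_measurable (count_space UNIV)" "(\<lambda>i. m i) \<in> borel_measurable (count_space UNIV)"
    by auto
  have [measurable]: "u \<in> borel_measurable borel" "v \<in> borel_measurable borel"
    unfolding u_def v by measurable
  have kb[measurable]: "k -` {i} \<in> sets borel" for i
    using measurable_sets[OF k, of "{i}"] by simp
  \<comment> \<open>With respect to the product measure, the density 1 / max(p, q) on a cell yields
    total mass p q / max(p, q) = min(p, q).\<close>
  define W :: "'a \<Rightarrow> 'a \<Rightarrow> ennreal" where "W = (\<lambda>x' x. if k x' = k x then ennreal (1 / m (k x)) else 0)"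
  have W[measurable]: "(\<lambda>w. W (fst w) (snd w)) \<in> borel_measurable (borel \<Otimes>\<^sub>M borel)"
  proof -
    have [measurable]: "(\<lambda>x. real (k x)) \<in> borel_measurable borel" by measurable
    have "Measurable.pred (borel \<Otimes>\<^sub>M borel) (\<lambda>w. real (k (fst w)) = real (k (snd w)))" by measurable
    then have [measurable]: "Measurable.pred (borel \<Otimes>\<^sub>M borel) (\<lambda>w. k (fst w) = k (snd w))" by simp
    show ?thesis unfolding W_def by measurable
  qed
  have Wx[measurable]: "(\<lambda>z. W x (fst z)) \<in> borel_measurable \<pi>" for x
    using measurable_compose[of "\<lambda>z. (x, fst z)" "\<pi>" _ _ _, OF _ W] by simp
  have Wz[measurable]: "(\<lambda>x. W x y) \<in> borel_measurable \<nu>'" for y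
    using measurable_compose[of "\<lambda>x. (x, y)" "\<nu>'" _ _ _, OF _ W] by simp
  have Wp[measurable]: "(\<lambda>w. W (fst w) (fst (snd w))) \<in> borel_measurable (\<nu>' \<Otimes>\<^sub>M \<pi>)"
    using measurable_compose[of "\<lambda>w. (fst w, fst (snd w))" "\<nu>' \<Otimes>\<^sub>M \<pi>" _ _ _, OF _ W] by simp
  have W1: "(\<integral>\<^sup>+ z. W x (fst z) \<partial>\<pi>) = ennreal (u x)" for x
  proof -
    have "(\<integral>\<^sup>+ z. W x (fst z) \<partial>\<pi>) = (\<integral>\<^sup>+ y. W x y \<partial>distr \<pi> borel fst)"
      by (subst nn_integral_distr) (auto simp: W_def)
    also have "\<dots> = (\<integral>\<^sup>+ y. ennreal (1 / m (k x)) * indicator (k -` {k x}) y \<partial>\<nu>)"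
      unfolding couplingsD(3)[OF pi] by (intro nn_integral_cong) (auto simp: W_def indicator_def)
    also have "\<dots> = ennreal (1 / m (k x)) * emeasure \<nu> (k -` {k x})"
      by (subst nn_integral_cmult_indicator) (auto simp: s kb)
    also have "\<dots> = ennreal (u x)"
      using m0[of "k x"] by (simp add: N.emeasure_eq_measure u_def q_def flip: ennreal_mult)
    finally show ?thesis .
  qed
  have W2: "(\<integral>\<^sup>+ x. W x y \<partial>\<nu>') = ennreal (v y)" for y
  proof -
    have "(\<integral>\<^sup>+ x. W x y \<partial>\<nu>') = (\<integral>\<^sup>+ x. ennreal (1 / m (k y)) * indicator (k -` {k y}) x \<partial>\<nu>')"
      by (intro nn_integral_cong) (auto simp: W_def indicator_def)
    also have "\<dots> = ennreal (1 / m (k y)) * emeasure \<nu>' (k -` {k y})"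
      by (subst nn_integral_cmult_indicator) (auto simp: s kb)
    also have "\<dots> = ennreal (v y)"
      using m0[of "k y"] by (simp add: N'.emeasure_eq_measure v p_def flip: ennreal_mult)
    finally show ?thesis .
  qed
  define e where "e = (\<integral>\<^sup>+ z. ennreal (1 - v (fst z)) \<partial>\<pi>)"
  \<comment> \<open>The leftovers on the two sides have the same mass, because Fubini computes the
    integral of W in either order; therefore they can be matched with each other.\<close>
  have e: "(\<integral>\<^sup>+ x. ennreal (1 - u x) \<partial>\<nu>') = e"
  proof -
    have le1: "(\<integral>\<^sup>+ x. ennreal (u x) \<partial>\<nu>') \<le> (\<integral>\<^sup>+ x. 1 \<partial>\<nu>')" "(\<integral>\<^sup>+ z. ennreal (v (fst z)) \<partial>\<pi>) \<le> (\<integral>\<^sup>+ z. 1 \<partial>\<pi>)"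
      using u01 v01 by (intro nn_integral_mono, simp add: ennreal_le_1)+
    then have fin: "(\<integral>\<^sup>+ x. ennreal (u x) \<partial>\<nu>') \<noteq> \<infinity>" "(\<integral>\<^sup>+ z. ennreal (v (fst z)) \<partial>\<pi>) \<noteq> \<infinity>"
      by (auto simp: N'.emeasure_space_1 Q.emeasure_space_1 top_unique)
    have "(\<integral>\<^sup>+ x. ennreal (1 - u x) \<partial>\<nu>') = (\<integral>\<^sup>+ x. 1 - ennreal (u x) \<partial>\<nu>')"
      using u01 by (simp add: ennreal_minus[symmetric])
    also have "\<dots> = 1 - (\<integral>\<^sup>+ x. ennreal (u x) \<partial>\<nu>')"
      using fin u01 by (subst nn_integral_diff) (auto simp: N'.emeasure_space_1 ennreal_le_1)
    also have "(\<integral>\<^sup>+ x. ennreal (u x) \<partial>\<nu>') = (\<integral>\<^sup>+ z. ennreal (v (fst z)) \<partial>\<pi>)"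
      unfolding W1[symmetric] W2[symmetric]
      using NQ.Fubini[OF Wp] by simp
    also have "1 - \<dots> = (\<integral>\<^sup>+ z. 1 - ennreal (v (fst z)) \<partial>\<pi>)"
      using fin v01 by (subst nn_integral_diff) (auto simp: Q.emeasure_space_1 ennreal_le_1)
    also have "\<dots> = e" unfolding e_def using v01 by (simp add: ennreal_minus[symmetric])
    finally show ?thesis .
  qed
  have "e \<le> (\<integral>\<^sup>+ z. 1 \<partial>\<pi>)" unfolding e_def
    using v01 by (intro nn_integral_mono) (simp add: ennreal_le_1)
  then have e1: "e \<le> 1" by (simp add: Q.emeasure_space_1)
  \<comment> \<open>The normalization of the product of leftovers. If e = 0, then
    \<open>1 / 0 = 0\<close> makes the remainder vanish.\<close>
  define i where "i = ennreal (1 / enn2real e)"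
  have ie: "i * e = (if e = 0 then 0 else 1)"
  proof (cases e)
    case (real r)
    then show ?thesis using e1 by (auto simp: i_def simp flip: ennreal_mult)
  qed (use e1 in \<open>auto simp: top_unique\<close>)
  then have ie1: "i * e \<le> 1" by simp
  define R where "R = (\<lambda>x y. ennreal (1 - u x) * ennreal (1 - v y) * i)"
  have [measurable]: "(\<lambda>w. R (fst w) (snd w)) \<in> borel_measurable (borel \<Otimes>\<^sub>M borel)"
    unfolding R_def by measurable
  have Rx[measurable]: "(\<lambda>z. R x (fst z)) \<in> borel_measurable \<pi>" for x
    unfolding R_def by measurable
  have Rz[measurable]: "(\<lambda>x. R x y) \<in> borel_measurable \<nu>'" for y
    unfolding R_def by measurable
  have R1: "(\<integral>\<^sup>+ z. R x (fst z) \<partial>\<pi>) = ennreal (1 - u x) * (i * e)" for x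
    unfolding R_def by (simp add: nn_integral_cmult nn_integral_multc e_def[symmetric] ac_simps)
  have R2: "(\<integral>\<^sup>+ x. R x y \<partial>\<nu>') = ennreal (1 - v y) * (i * e)" for y
    unfolding R_def by (simp add: nn_integral_cmult nn_integral_multc e ac_simps)
  have "transport_cost c \<nu>' \<mu> \<le> (\<integral>\<^sup>+ x. \<integral>\<^sup>+ z. (W x (fst z) + R x (fst z)) * ennreal (c x (snd z)) \<partial>\<pi> \<partial>\<nu>')"
  proof (rule transport_cost_glue[OF nu' pi])
    have one: "ennreal t + ennreal (1 - t) * (i * e) = 1" if "0 \<le> t" "t \<le> 1" "e = 0 \<Longrightarrow> t = 1" for t
      using that by (auto simp: ie simp flip: ennreal_plus)
    \<comment> \<open>Without leftover mass the local part alone must already have the right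
      marginals almost everywhere.\<close>
    have "e = 0 \<longrightarrow> (AE x in \<nu>'. u x = 1)"
    proof
      assume "e = 0"
      then have "AE x in \<nu>'. ennreal (1 - u x) = 0" using e by (subst nn_integral_0_iff_AE[symmetric]) auto
      then show "AE x in \<nu>'. u x = 1" by eventually_elim (use u01 in \<open>auto simp: ennreal_eq_0_iff intro: antisym\<close>)
    qed
    then have "AE x in \<nu>'. e = 0 \<longrightarrow> u x = 1" by auto
    then show "AE x in \<nu>'. (\<integral>\<^sup>+ z. W x (fst z) + R x (fst z) \<partial>\<pi>) = 1"
    proof eventually_elim
      case (elim x)
      then show ?case using u01 by (subst nn_integral_add) (auto simp: W1 R1 intro!: one)
    qed
    have "e = 0 \<longrightarrow> (AE z in \<pi>. v (fst z) = 1)"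
    proof
      assume "e = 0"
      then have "AE z in \<pi>. ennreal (1 - v (fst z)) = 0" unfolding e_def by (subst nn_integral_0_iff_AE[symmetric]) auto
      then show "AE z in \<pi>. v (fst z) = 1" by eventually_elim (use v01 in \<open>auto simp: ennreal_eq_0_iff intro: antisym\<close>)
    qed
    then have "AE z in \<pi>. e = 0 \<longrightarrow> v (fst z) = 1" by auto
    then show "AE z in \<pi>. (\<integral>\<^sup>+ x. W x (fst z) + R x (fst z) \<partial>\<nu>') = 1"
    proof eventually_elim
      case (elim z)
      then show ?case using v01 by (subst nn_integral_add) (auto simp: W2 R2 intro!: one)
    qed
  qed measurable
  \<comment> \<open>Points matched by W share a cell, so \<open>near\<close> applies; R pairs
    arbitrary points and is charged by \<open>far\<close>.\<close>
  also have "\<dots> \<le> (\<integral>\<^sup>+ x. \<integral>\<^sup>+ z. W x (fst z) * ennreal (A * c (fst z) (snd z) + D)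
      + R x (fst z) * ennreal (A * h x + C * h (snd z)) \<partial>\<pi> \<partial>\<nu>')"
  proof (intro nn_integral_mono)
    fix x z
    have "W x (fst z) * ennreal (c x (snd z)) \<le> W x (fst z) * ennreal (A * c (fst z) (snd z) + D)"
      using near[of x "fst z" "snd z"] by (cases "k x = k (fst z)") (auto simp: W_def intro!: mult_left_mono ennreal_leI)
    moreover have "R x (fst z) * ennreal (c x (snd z)) \<le> R x (fst z) * ennreal (A * h x + C * h (snd z))"
      using far by (intro mult_left_mono ennreal_leI) auto
    ultimately show "(W x (fst z) + R x (fst z)) * ennreal (c x (snd z)) \<le>
      W x (fst z) * ennreal (A * c (fst z) (snd z) + D) + R x (fst z) * ennreal (A * h x + C * h (snd z))"
      by (simp add: distrib_right add_mono)
  qed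
  also have "\<dots> = (\<integral>\<^sup>+ x. \<integral>\<^sup>+ z. W x (fst z) * ennreal (A * c (fst z) (snd z) + D) \<partial>\<pi> \<partial>\<nu>')
      + (\<integral>\<^sup>+ x. \<integral>\<^sup>+ z. R x (fst z) * ennreal (A * h x + C * h (snd z)) \<partial>\<pi> \<partial>\<nu>')"
    by (simp add: nn_integral_add R_def)
  also have "(\<integral>\<^sup>+ x. \<integral>\<^sup>+ z. W x (fst z) * ennreal (A * c (fst z) (snd z) + D) \<partial>\<pi> \<partial>\<nu>')
      \<le> ennreal A * (\<integral>\<^sup>+ z. ennreal (c (fst z) (snd z)) \<partial>\<pi>) + ennreal D"
  proof -
    have "(\<integral>\<^sup>+ x. \<integral>\<^sup>+ z. W x (fst z) * ennreal (A * c (fst z) (snd z) + D) \<partial>\<pi> \<partial>\<nu>')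
        = (\<integral>\<^sup>+ z. \<integral>\<^sup>+ x. W x (fst z) * ennreal (A * c (fst z) (snd z) + D) \<partial>\<nu>' \<partial>\<pi>)"
      using NQ.Fubini[of "\<lambda>w. W (fst w) (fst (snd w)) * ennreal (A * c (fst (snd w)) (snd (snd w)) + D)"]
      by simp
    also have "\<dots> = (\<integral>\<^sup>+ z. ennreal (v (fst z)) * ennreal (A * c (fst z) (snd z) + D) \<partial>\<pi>)"
      by (simp add: nn_integral_multc W2)
    also have "\<dots> \<le> (\<integral>\<^sup>+ z. 1 * ennreal (A * c (fst z) (snd z) + D) \<partial>\<pi>)"
      using v01 by (intro nn_integral_mono mult_right_mono) (auto simp: ennreal_le_1)
    also have "\<dots> = (\<integral>\<^sup>+ z. ennreal A * ennreal (c (fst z) (snd z)) + ennreal D \<partial>\<pi>)"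
      using pos by (simp add: ennreal_plus ennreal_mult)
    also have "\<dots> = ennreal A * (\<integral>\<^sup>+ z. ennreal (c (fst z) (snd z)) \<partial>\<pi>) + ennreal D"
      by (simp add: nn_integral_add nn_integral_cmult Q.emeasure_space_1)
    finally show ?thesis .
  qed
  also have "(\<integral>\<^sup>+ x. \<integral>\<^sup>+ z. R x (fst z) * ennreal (A * h x + C * h (snd z)) \<partial>\<pi> \<partial>\<nu>')
      \<le> ennreal A * (ennreal M * e + (\<integral>\<^sup>+ x. ennreal (h x * indicator {x. M < h x} x) \<partial>\<nu>'))
      + ennreal C * (\<integral>\<^sup>+ z. ennreal ((1 - v (fst z)) * h (snd z)) \<partial>\<pi>)" (is "_ \<le> ?A + ennreal C * ?J")
  proof -
    have J: "?J = (\<integral>\<^sup>+ z. ennreal (1 - v (fst z)) * ennreal (h (snd z)) \<partial>\<pi>)"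
      using v01 pos by (simp add: ennreal_mult)
    have "(\<integral>\<^sup>+ z. R x (fst z) * ennreal (A * h x + C * h (snd z)) \<partial>\<pi>)
        = ennreal A * (ennreal (1 - u x) * ennreal (h x)) * (i * e) + ennreal C * ?J * i * ennreal (1 - u x)" for x
    proof -
      have "(\<integral>\<^sup>+ z. R x (fst z) * ennreal (A * h x + C * h (snd z)) \<partial>\<pi>)
         = (\<integral>\<^sup>+ z. R x (fst z) * (ennreal A * ennreal (h x))
            + ennreal (1 - u x) * i * ennreal C * (ennreal (1 - v (fst z)) * ennreal (h (snd z))) \<partial>\<pi>)"
        using pos by (intro nn_integral_cong) (simp add: R_def ennreal_plus ennreal_mult distrib_left ac_simps)
      also have "\<dots> = ennreal (1 - u x) * (i * e) * (ennreal A * ennreal (h x)) + ennreal (1 - u x) * i * ennreal C * ?J"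
        unfolding J by (subst nn_integral_add) (simp_all add: nn_integral_multc nn_integral_cmult R1)
      finally show ?thesis by (simp add: ac_simps)
    qed
    then have "(\<integral>\<^sup>+ x. \<integral>\<^sup>+ z. R x (fst z) * ennreal (A * h x + C * h (snd z)) \<partial>\<pi> \<partial>\<nu>')
        = ennreal A * (\<integral>\<^sup>+ x. ennreal (1 - u x) * ennreal (h x) \<partial>\<nu>') * (i * e) + ennreal C * ?J * (i * e)"
      by (simp add: nn_integral_add nn_integral_multc nn_integral_cmult e) (simp add: mult.assoc)
    also have "\<dots> \<le> ennreal A * (\<integral>\<^sup>+ x. ennreal (1 - u x) * ennreal (h x) \<partial>\<nu>') * 1 + ennreal C * ?J * 1"
      using ie1 by (intro add_mono mult_left_mono) auto
    also have "(\<integral>\<^sup>+ x. ennreal (1 - u x) * ennreal (h x) \<partial>\<nu>')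
        \<le> (\<integral>\<^sup>+ x. ennreal M * ennreal (1 - u x) + ennreal (h x * indicator {x. M < h x} x) \<partial>\<nu>')"
    proof (intro nn_integral_mono)
      fix x
      have "(1 - u x) * h x \<le> M * (1 - u x) + h x * indicator {x. M < h x} x"
      proof (cases "M < h x")
        case True
        have "(1 - u x) * h x \<le> h x" using u01[of x] pos(6)[of x] by (simp add: mult_left_le_one_le)
        then show ?thesis using True u01[of x] pos(4) by (simp add: add_increasing)
      next
        case False
        then show ?thesis using u01[of x] mult_left_mono[of "h x" M "1 - u x"] by (simp add: mult.commute)
      qed
      then show "ennreal (1 - u x) * ennreal (h x) \<le> ennreal M * ennreal (1 - u x) + ennreal (h x * indicator {x. M < h x} x)"
        using u01[of x] pos by (simp add: ennreal_mult[symmetric] ennreal_plus[symmetric] ennreal_leI del: ennreal_plus)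
    qed
    also have "\<dots> = ennreal M * e + (\<integral>\<^sup>+ x. ennreal (h x * indicator {x. M < h x} x) \<partial>\<nu>')"
      by (simp add: nn_integral_add nn_integral_cmult e)
    finally show ?thesis by (simp add: mult_left_mono)
  qed
  finally show ?thesis unfolding e_def by (simp add: add.assoc)
qed

section \<open>Exponential moments from concentration\<close>

text \<open>Slice the values of h into unit intervals beyond n. The growth exp(1/b) from one slice
  to the next loses against the decay exp(-1/b1) of the tail, leaving a geometric series.\<close>

lemma integrable_exp_of_exponential_tail:
  fixes h :: "'a \<Rightarrow> real"
  assumes "prob_space M" and [measurable]: "h \<in> borel_measurable M"
    and b: "0 < b\<^sub>1" "b\<^sub>1 < b"
    and tail: "\<forall>\<^sub>F s in at_top. measure M {x \<in> space M. s < h x} \<le> exp (- s / b\<^sub>1)"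
  shows "integrable M (\<lambda>x. exp (h x / b))"
proof -
  interpret prob_space M by fact
  obtain s0 where s0: "\<And>s. s \<ge> s0 \<Longrightarrow> measure M {x \<in> space M. s < h x} \<le> exp (- s / b\<^sub>1)"
    using tail by (auto simp: eventually_at_top_linorder)
  define n where "n = nat \<lceil>s0\<rceil>"
  have n: "s0 \<le> real n" unfolding n_def by linarith
  define w where "w = (\<lambda>j. exp (real (n + j + 1) / b))"
  have term_le: "t j \<le> (\<Sum>j. t j)" for t :: "nat \<Rightarrow> ennreal" and j
    using sum_le_suminf[OF summableI, of "{j}" t] by simp
  have pw: "ennreal (exp (h x / b)) \<le> ennreal (exp (real (n + 1) / b))
      + (\<Sum>j. ennreal (w j) * indicator {x \<in> space M. real (n + j) < h x} x)" if x: "x \<in> space M" for x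
  proof (cases "h x \<le> real (n + 1)")
    case True
    then have "ennreal (exp (h x / b)) \<le> ennreal (exp (real (n + 1) / b))"
      using b by (intro ennreal_leI) (auto intro: divide_right_mono)
    then show ?thesis by (rule order_trans) simp
  next
    case False
    \<comment> \<open>The index of the slice containing h x, half open on the left: n + j < h x
      \<le> n + j + 1.\<close>
    define j where "j = nat \<lceil>h x\<rceil> - 1 - n"
    have j: "real (n + j) < h x" "h x \<le> real (n + j + 1)"
      using False unfolding j_def by linarith+
    have "ennreal (exp (h x / b)) \<le> ennreal (w j) * indicator {x \<in> space M. real (n + j) < h x} x"
      using j b x by (auto simp: w_def intro!: ennreal_leI divide_right_mono)
    also have "\<dots> \<le> (\<Sum>j. ennreal (w j) * indicator {x \<in> space M. real (n + j) < h x} x)"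
      by (rule term_le)
    finally show ?thesis by (rule order_trans) simp
  qed
  define q where "q = exp (1 / b - 1 / b\<^sub>1)"
  define K where "K = exp (real (n + 1) / b - real n / b\<^sub>1)"
  have q: "q < 1" "0 < q" unfolding q_def using b by (auto simp: divide_strict_left_mono)
  have tail': "w j * measure M {x \<in> space M. real (n + j) < h x} \<le> K * q ^ j" for j
  proof -
    have "w j * measure M {x \<in> space M. real (n + j) < h x} \<le> w j * exp (- real (n + j) / b\<^sub>1)"
      using n by (intro mult_left_mono s0) (auto simp: w_def)
    also have "\<dots> = exp (real (n + j + 1) / b - real (n + j) / b\<^sub>1)"
      unfolding w_def by (simp add: exp_add[symmetric] diff_divide_distrib add_divide_distrib)
    also have "real (n + j + 1) / b - real (n + j) / b\<^sub>1
        = (real (n + 1) / b - real n / b\<^sub>1) + real j * (1 / b - 1 / b\<^sub>1)"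
      using b by (simp add: field_simps)
    also have "exp \<dots> = K * q ^ j" unfolding K_def q_def by (subst exp_add) (simp add: exp_of_nat_mult)
    finally show ?thesis .
  qed
  have "(\<integral>\<^sup>+ x. ennreal (exp (h x / b)) \<partial>M) \<le> (\<integral>\<^sup>+ x. ennreal (exp (real (n + 1) / b))
      + (\<Sum>j. ennreal (w j) * indicator {x \<in> space M. real (n + j) < h x} x) \<partial>M)"
    using pw by (intro nn_integral_mono)
  also have "\<dots> = ennreal (exp (real (n + 1) / b))
      + (\<Sum>j. ennreal (w j) * emeasure M {x \<in> space M. real (n + j) < h x})"
    by (subst nn_integral_add) (simp_all add: nn_integral_suminf nn_integral_cmult emeasure_space_1)
  also have "\<dots> \<le> ennreal (exp (real (n + 1) / b)) + (\<Sum>j. ennreal (K * q ^ j))"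
    using tail' by (intro add_left_mono suminf_le)
      (auto simp: emeasure_eq_measure w_def intro!: ennreal_leI simp flip: ennreal_mult)
  also have "\<dots> < \<infinity>"
  proof -
    have "summable (\<lambda>j. K * q ^ j)" using q by (intro summable_mult summable_geometric) auto
    then have "(\<Sum>j. ennreal (K * q ^ j)) \<noteq> \<top>"
      using q by (intro ennreal_suminf_neq_top) (auto simp: K_def)
    then show ?thesis by (simp add: less_top)
  qed
  finally show ?thesis by (intro integrableI_nonneg) auto
qed

lemma measurable_power_cost:
  fixes f g :: "'b \<Rightarrow> 'a::{metric_space, second_countable_topology}"
  assumes "power_type \<phi>" and [measurable]: "f \<in> measurable M borel" "g \<in> measurable M borel"
  shows "(\<lambda>x. \<phi> (dist (f x) (g x))) \<in> borel_measurable M"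
proof -
  have [measurable]: "(\<lambda>x. \<phi> (max 0 x)) \<in> borel_measurable borel" by (rule power_type_measurable[OF assms(1)])
  have "(\<lambda>x. \<phi> (max 0 (dist (f x) (g x)))) \<in> borel_measurable M" by measurable
  then show ?thesis by simp
qed

text \<open>A large ball around \<open>x\<^sub>0\<close> has mass at least 1/2, and on its
  r-enlargement h \<le> A r^p + K. Concentration therefore makes the tail of h at level s decay
  almost like exp(-s / a'). The completion appears because the enlargement of a Borel set need not
  be Borel.\<close>

lemma concentration_exp_integrable:
  fixes \<mu> :: "'a::polish_space measure" and \<phi> :: "real \<Rightarrow> real"
  defines "p \<equiv> power_exponent \<phi>"
  defines "dt \<equiv> \<lambda>x y. (\<phi> (dist x y)) powr (1 / p)"
  assumes mu: "\<mu> \<in> prob_measures" and phi: "power_type \<phi>" and a': "a' > 0"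
    and conc: "\<And>A r. A \<in> sets borel \<Longrightarrow> measure \<mu> A \<ge> 1/2 \<Longrightarrow> r \<ge> r\<^sub>o \<Longrightarrow>
        measure (completion \<mu>) (enlargement dt A r) \<ge> 1 - exp (- ((r - r\<^sub>o) powr p) / a')"
    and b: "a' < b"
  shows "integrable \<mu> (\<lambda>x. exp (\<phi> (dist x x\<^sub>0) / b))"
proof -
  have s[measurable_cong]: "sets \<mu> = sets borel" and "prob_space \<mu>" using mu by (auto simp: prob_measures_def)
  interpret prob_space \<mu> by fact
  have sp: "space \<mu> = UNIV" using sets_eq_imp_space_eq[OF s] by simp
  interpret C: finite_measure "completion \<mu>"
    by (intro finite_measureI) (simp add: emeasure_space_1)
  define h where "h = (\<lambda>x. \<phi> (dist x x\<^sub>0))"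
  have h[measurable]: "h \<in> borel_measurable borel" unfolding h_def by (intro measurable_power_cost phi) auto
  have p: "p \<ge> 1" unfolding p_def by (rule power_exponent_ge_1[OF phi])
  \<comment> \<open>Two margins are needed: a' < b1 absorbs A, K and the shift of r in the tail
    rate, and b1 < b makes the exponential moment finite.\<close>
  define b1 where "b1 = (a' + b) / 2"
  have b1: "a' < b1" "b1 < b" "0 < b1" using a' b by (auto simp: b1_def)
  define A where "A = (1 + b1 / a') / 2"
  have A: "1 < A" "A < b1 / a'" using a' b1 by (auto simp: A_def field_simps)
  obtain C where C: "0 \<le> C" "\<And>s t. 0 \<le> s \<Longrightarrow> 0 \<le> t \<Longrightarrow> \<phi> (s + t) \<le> A * \<phi> s + C * \<phi> t"
    using power_type_almost_subadditive[OF phi A(1)] by blast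
  have "(\<lambda>n. measure \<mu> (cball x\<^sub>0 (real n))) \<longlonglongrightarrow> measure \<mu> (\<Union>n. cball x\<^sub>0 (real n))"
    by (intro finite_Lim_measure_incseq) (auto simp: s incseq_def)
  moreover have "(\<Union>n. cball x\<^sub>0 (real n)) = space \<mu>"
    by (auto simp: sp real_arch_simple)
  ultimately have "(\<lambda>n. measure \<mu> (cball x\<^sub>0 (real n))) \<longlonglongrightarrow> 1" by (simp add: prob_space)
  then have "\<forall>\<^sub>F n in sequentially. 1/2 < measure \<mu> (cball x\<^sub>0 (real n))" by (rule order_tendstoD) simp
  then obtain R where R: "1/2 \<le> measure \<mu> (cball x\<^sub>0 (real R))"
    by (metis eventually_sequentially less_imp_le order_refl)
  define K where "K = C * \<phi> (real R)"
  have tail: "measure \<mu> {x \<in> space \<mu>. A * r powr p + K < h x} \<le> exp (- ((r - r\<^sub>o) powr p) / a')"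
    if r: "r\<^sub>o \<le> r" "0 \<le> r" for r
  proof -
    have "enlargement dt (cball x\<^sub>0 (real R)) r \<subseteq> {x \<in> space \<mu>. h x \<le> A * r powr p + K}"
    proof
      fix x assume "x \<in> enlargement dt (cball x\<^sub>0 (real R)) r"
      then obtain y where y: "dist x\<^sub>0 y \<le> real R" "dt x y \<le> r" by (auto simp: enlargement_def)
      have nn: "0 \<le> \<phi> (dist x y)" by (intro power_type_nonneg[OF phi]) simp
      have "dt x y powr p \<le> r powr p" using y p by (intro powr_mono2) (auto simp: dt_def)
      then have xy: "\<phi> (dist x y) \<le> r powr p" using p nn by (simp add: dt_def powr_powr)
      have "h x \<le> \<phi> (dist x y + dist x\<^sub>0 y)" unfolding h_def
        by (intro power_type_mono[OF phi]) (auto simp: dist_triangle2)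
      also have "\<dots> \<le> A * \<phi> (dist x y) + C * \<phi> (dist x\<^sub>0 y)" by (intro C) auto
      also have "\<dots> \<le> A * r powr p + K" unfolding K_def using A C xy y
        by (intro add_mono mult_left_mono power_type_mono[OF phi]) auto
      finally show "x \<in> {x \<in> space \<mu>. h x \<le> A * r powr p + K}" by (simp add: sp)
    qed
    then have "measure (completion \<mu>) (enlargement dt (cball x\<^sub>0 (real R)) r)
        \<le> measure (completion \<mu>) {x \<in> space \<mu>. h x \<le> A * r powr p + K}"
      by (intro C.finite_measure_mono) (auto intro!: sets_completionI_sets)
    also have "\<dots> = measure \<mu> {x \<in> space \<mu>. h x \<le> A * r powr p + K}" by simp
    also have "\<dots> = 1 - measure \<mu> {x \<in> space \<mu>. \<not> h x \<le> A * r powr p + K}"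
      by (subst prob_neg) auto
    finally show ?thesis using conc[of "cball x\<^sub>0 (real R)" r] R r by (simp add: not_le)
  qed
  \<comment> \<open>Divided by r^p, the two exponents to be compared tend to A / b1 and 1 / a', and
    A < b1 / a' separates these limits.\<close>
  have "((\<lambda>r. (A + K / r powr p) / b1) \<longlongrightarrow> (A + 0) / b1) at_top"
    using p by (intro tendsto_intros) (real_asymp, use b1 in auto)
  moreover have "((\<lambda>r. ((r - r\<^sub>o) / r) powr p / a') \<longlongrightarrow> 1 powr p / a') at_top"
    using p a' by (intro tendsto_intros) (real_asymp, auto)
  ultimately have "((\<lambda>r. ((r - r\<^sub>o) / r) powr p / a' - (A + K / r powr p) / b1) \<longlongrightarrow>
      1 powr p / a' - (A + 0) / b1) at_top"
    by (intro tendsto_diff)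
  moreover have "0 < 1 powr p / a' - (A + 0) / b1" using A b1 a' by (simp add: field_simps)
  ultimately have "\<forall>\<^sub>F r in at_top. 0 < ((r - r\<^sub>o) / r) powr p / a' - (A + K / r powr p) / b1"
    by (rule order_tendstoD)
  then have "\<forall>\<^sub>F r in at_top. (A * r powr p + K) / b1 \<le> (r - r\<^sub>o) powr p / a' \<and> r\<^sub>o \<le> r \<and> 0 \<le> r"
    using eventually_ge_at_top[of "max 1 r\<^sub>o"]
  proof eventually_elim
    case (elim r)
    then have pos: "r powr p > 0" by simp
    have "r powr p * ((A + K / r powr p) / b1) \<le> r powr p * (((r - r\<^sub>o) / r) powr p / a')"
      using elim pos by (intro mult_left_mono) auto
    also have "r powr p * (((r - r\<^sub>o) / r) powr p / a') = (r - r\<^sub>o) powr p / a'"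
      using elim pos by (simp add: powr_divide)
    also have "r powr p * ((A + K / r powr p) / b1) = (A * r powr p + K) / b1"
      using pos b1 by (simp add: field_simps)
    finally show ?case using elim by auto
  qed
  \<comment> \<open>The substitution inverts s = A r^p + K and turns the estimate in r into a tail
    bound at level s.\<close>
  moreover have "LIM s at_top. ((s - K) / A) powr (1 / p) :> at_top"
    using A p by real_asymp
  ultimately have "\<forall>\<^sub>F s in at_top.
      (A * (((s - K) / A) powr (1 / p)) powr p + K) / b1 \<le> (((s - K) / A) powr (1 / p) - r\<^sub>o) powr p / a'
      \<and> r\<^sub>o \<le> ((s - K) / A) powr (1 / p) \<and> 0 \<le> ((s - K) / A) powr (1 / p)"
    by (rule eventually_compose_filterlim)
  then have "\<forall>\<^sub>F s in at_top. measure \<mu> {x \<in> space \<mu>. s < h x} \<le> exp (- s / b1)"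
    using eventually_ge_at_top[of K]
  proof eventually_elim
    case (elim s)
    let ?r = "((s - K) / A) powr (1 / p)"
    have "?r powr p = (s - K) / A" using elim p A by (simp add: powr_powr)
    then have eq: "A * ?r powr p + K = s" using A by (simp only:) simp
    have "measure \<mu> {x \<in> space \<mu>. s < h x} \<le> exp (- ((?r - r\<^sub>o) powr p) / a')"
      using tail[of ?r] elim unfolding eq by simp
    also have "\<dots> \<le> exp (- s / b1)" using elim unfolding eq by simp
    finally show ?case .
  qed
  then have "integrable \<mu> (\<lambda>x. exp (h x / b))"
    using integrable_exp_of_exponential_tail[OF \<open>prob_space \<mu>\<close>, of h b1 b] b1 by simp
  then show ?thesis by (simp add: h_def)
qed

section \<open>Lower semicontinuity\<close>

text \<open>Each point receives the index of the first member of a dense sequence within \<delta> /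
  2 of it, so equal indices mean distance at most \<delta>.\<close>

lemma countable_small_cells:
  fixes \<delta> :: real
  assumes "\<delta> > 0"
  obtains k :: "'a::{metric_space, second_countable_topology} \<Rightarrow> nat"
  where "k \<in> measurable borel (count_space UNIV)" "\<And>x x'. k x = k x' \<Longrightarrow> dist x x' \<le> \<delta>"
proof -
  obtain D :: "'a set" where D: "countable D" "\<And>X. open X \<Longrightarrow> X \<noteq> {} \<Longrightarrow> \<exists>d\<in>D. d \<in> X"
    using countable_dense_exists by blast
  define d where "d = from_nat_into D"
  define k where "k = (\<lambda>x. LEAST i. dist (d i) x < \<delta> / 2)"
  have ex: "\<exists>i. dist (d i) x < \<delta> / 2" for x
  proof -
    have "\<exists>y\<in>D. y \<in> ball x (\<delta> / 2)" using assms by (intro D(2)) auto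
    then obtain y where "y \<in> D" "dist y x < \<delta> / 2" by (auto simp: dist_commute)
    then show ?thesis unfolding d_def using D(1) by (metis from_nat_into_to_nat_on)
  qed
  have k: "dist (d (k x)) x < \<delta> / 2" for x
    unfolding k_def using ex[of x] by (rule LeastI_ex)
  show thesis
  proof
    show "k \<in> measurable borel (count_space UNIV)" unfolding k_def by measurable
    show "dist x x' \<le> \<delta>" if "k x = k x'" for x x'
      using dist_triangle3[of x x' "d (k x)"] k[of x] k[of x'] that by simp
  qed
qed

text \<open>There are countably many cells, so those of mass zero can be discarded together.\<close>

lemma cell_mass_pos:
  fixes k :: "'a \<Rightarrow> nat"
  assumes "prob_space L" and k: "k \<in> measurable L (count_space UNIV)"
  shows "AE x in L. 0 < measure L {y \<in> space L. k y = k x}"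
proof -
  interpret prob_space L by fact
  have "AE x in L. measure L {y \<in> space L. k y = i} = 0 \<longrightarrow> k x \<noteq> i" for i
  proof (cases "measure L {y \<in> space L. k y = i} = 0")
    case True
    have "{y \<in> space L. k y = i} \<in> sets L" using k by measurable
    then have "{y \<in> space L. k y = i} \<in> null_sets L" using True by (auto simp: null_sets_def emeasure_eq_measure)
    then show ?thesis by (auto dest: AE_not_in)
  qed simp
  then have "AE x in L. \<forall>i. measure L {y \<in> space L. k y = i} = 0 \<longrightarrow> k x \<noteq> i" by (simp add: AE_all_countable)
  then show ?thesis by eventually_elim (auto simp: zero_less_measure_iff)
qed

lemma divide_max_bounds:
  fixes p q :: real
  assumes "0 \<le> p"
  shows "0 \<le> p / max p q" "p / max p q \<le> 1"
  using assms by (auto simp: max_def divide_le_eq_1)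

text \<open>On a cell of positive L-mass the ratio tends to 1 by setwise convergence, and almost
  every point lies in such a cell. Dominated convergence with majorant |g| concludes, without any
  uniformity over the cells.\<close>

lemma cell_deficit_tendsto_0:
  fixes L :: "'a::topological_space measure" and k :: "'a \<Rightarrow> nat" and g :: "'a \<times> 'a \<Rightarrow> real"
  assumes N: "\<And>n. N n \<in> prob_measures" and L: "L \<in> prob_measures" and pi: "\<pi> \<in> couplings L \<mu>"
    and conv: "\<And>A. A \<in> sets borel \<Longrightarrow> (\<lambda>n. measure (N n) A) \<longlonglongrightarrow> measure L A"
    and k[measurable]: "k \<in> measurable borel (count_space UNIV)"
    and g: "integrable \<pi> g"
  defines "v \<equiv> \<lambda>n x. measure (N n) (k -` {k x}) / max (measure (N n) (k -` {k x})) (measure L (k -` {k x}))"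
  shows "integrable \<pi> (\<lambda>z. (1 - v n (fst z)) * g z)"
    and "(\<lambda>n. \<integral>z. (1 - v n (fst z)) * g z \<partial>\<pi>) \<longlonglongrightarrow> 0"
proof -
  have s[measurable_cong]: "sets L = sets borel" "sets \<pi> = sets (borel \<Otimes>\<^sub>M borel)"
    and "prob_space L" "prob_space \<pi>"
    using L couplingsD[OF pi] by (auto simp: prob_measures_def)
  have sp: "space L = UNIV" using sets_eq_imp_space_eq[OF s(1)] by simp
  define m where "m = (\<lambda>n i. measure (N n) (k -` {i}) / max (measure (N n) (k -` {i})) (measure L (k -` {i})))"
  have v: "v = (\<lambda>n x. m n (k x))" by (simp add: v_def m_def)
  have m01: "0 \<le> m n i" "m n i \<le> 1" for n i
    unfolding m_def by (intro divide_max_bounds measure_nonneg)+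
  have [measurable]: "m n \<in> borel_measurable (count_space UNIV)" for n by auto
  have [measurable]: "g \<in> borel_measurable \<pi>" using g by auto
  have bound: "norm ((1 - v n (fst z)) * g z) \<le> norm (g z)" for n z
    using m01[of n "k (fst z)"] by (simp add: v abs_mult mult_left_le_one_le)
  have lim: "AE z in \<pi>. (\<lambda>n. (1 - v n (fst z)) * g z) \<longlonglongrightarrow> 0"
  proof -
    have "AE x in L. 0 < measure L (k -` {k x})"
      using cell_mass_pos[OF \<open>prob_space L\<close>, of k] by (simp add: sp vimage_def)
    then have "AE x in distr \<pi> borel fst. 0 < measure L (k -` {k x})" unfolding couplingsD(3)[OF pi] .
    then have "AE z in \<pi>. 0 < measure L (k -` {k (fst z)})" by (rule AE_distrD[rotated]) measurable
    then show ?thesis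
    proof eventually_elim
      case (elim z)
      let ?q = "measure L (k -` {k (fst z)})"
      have "k -` {k (fst z)} \<in> sets borel"
        using measurable_sets[OF k, of "{k (fst z)}"] by simp
      then have "(\<lambda>n. measure (N n) (k -` {k (fst z)})) \<longlonglongrightarrow> ?q" by (rule conv)
      then have "(\<lambda>n. (1 - v n (fst z)) * g z) \<longlonglongrightarrow> (1 - ?q / max ?q ?q) * g z"
        unfolding v_def using elim by (intro tendsto_intros) auto
      then show ?case using elim by simp
    qed
  qed
  show "integrable \<pi> (\<lambda>z. (1 - v n (fst z)) * g z)"
    using bound by (intro Bochner_Integration.integrable_bound[OF g]) (auto simp: v)
  have "(\<lambda>n. \<integral>z. (1 - v n (fst z)) * g z \<partial>\<pi>) \<longlonglongrightarrow> (\<integral>z. 0 \<partial>\<pi>)"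
    using lim bound g by (intro integral_dominated_convergence[where w = "\<lambda>z. norm (g z)"]) (auto simp: v)
  then show "(\<lambda>n. \<integral>z. (1 - v n (fst z)) * g z \<partial>\<pi>) \<longlonglongrightarrow> 0" by simp
qed

text \<open>Mass escaping to infinity is controlled by testing the entropy against \<open>h / b\<close> on
  \<open>{h > M}\<close>: there the entropy gains \<open>a / b \<ge> A\<close> times what the transport cost can lose.\<close>
lemma entropy_minus_transport_limit:
  fixes \<mu> :: "'a::polish_space measure" and \<phi> :: "real \<Rightarrow> real" and x\<^sub>0 :: 'a
  defines "c \<equiv> \<lambda>x y. \<phi> (dist x y)" and "h \<equiv> \<lambda>x. \<phi> (dist x x\<^sub>0)"
  assumes mu: "\<mu> \<in> prob_measures" and phi: "power_type \<phi>"
    and N: "\<And>n. N n \<in> prob_measures" and L: "L \<in> prob_measures" and pi: "\<pi> \<in> couplings L \<mu>"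
    and conv: "\<And>A. A \<in> sets borel \<Longrightarrow> (\<lambda>n. measure (N n) A) \<longlonglongrightarrow> measure L A"
    and b: "0 < b" and expint: "integrable \<mu> (\<lambda>x. exp (h x / b))"
    and H: "\<And>n. rel_entropy (N n) \<mu> \<le> ereal (H n)"
    and T: "\<And>n. transport_cost c (N n) \<mu> = ennreal (T n)" "\<And>n. 0 \<le> T n"
    and m: "(\<lambda>n. a * H n - T n) \<longlonglongrightarrow> m"
    and cpi: "(\<integral>\<^sup>+ z. ennreal (c (fst z) (snd z)) \<partial>\<pi>) = ennreal C\<pi>" "0 \<le> C\<pi>"
    and A: "1 < A" "A * b \<le> a" and D: "0 < D" and M: "0 \<le> M"
    and g[measurable]: "g \<in> borel_measurable borel" and B: "\<And>x. \<bar>g x\<bar> \<le> B"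
  shows "a * (\<integral>x. g x * indicator {x. h x \<le> M} x \<partial>L)
      - a * ln ((\<integral>x. exp (g x) \<partial>\<mu>) + (\<integral>x. exp (h x / b) * indicator {x. M < h x} x \<partial>\<mu>))
    \<le> m + A * C\<pi> + D"
proof -
  have s[measurable_cong]: "sets \<mu> = sets borel" "sets L = sets borel" "\<And>n. sets (N n) = sets borel"
      "sets \<pi> = sets (borel \<Otimes>\<^sub>M borel)"
    and p: "prob_space \<mu>" "prob_space L" "\<And>n. prob_space (N n)" "prob_space \<pi>"
    using mu L N couplingsD[OF pi] by (auto simp: prob_measures_def)
  interpret M: prob_space \<mu> by (rule p)
  interpret Q: prob_space \<pi> by (rule p)
  have h[measurable]: "h \<in> borel_measurable borel" unfolding h_def by (intro measurable_power_cost phi) auto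
  have c[measurable]: "(\<lambda>z. c (fst z) (snd z)) \<in> borel_measurable (borel \<Otimes>\<^sub>M borel)"
    unfolding c_def by (intro measurable_power_cost phi) auto
  have c0: "0 \<le> c x y" and h0: "0 \<le> h x" for x y
    unfolding c_def h_def by (auto intro: power_type_nonneg[OF phi])
  have a: "0 \<le> a" using A b mult_pos_pos[of A b] by linarith
  obtain C where C: "0 \<le> C" "\<And>s t. 0 \<le> s \<Longrightarrow> 0 \<le> t \<Longrightarrow> \<phi> (s + t) \<le> A * \<phi> s + C * \<phi> t"
    using power_type_almost_subadditive[OF phi A(1)] by blast
  \<comment> \<open>Since \<phi>(\<delta>) \<le> \<delta> \<phi>(1) for \<delta> \<le> 1, this cell
    size makes the error C \<phi>(\<delta>) at most D; the added 1 keeps the denominator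
    positive.\<close>
  define \<delta> where "\<delta> = min 1 (D / (C * \<phi> 1 + 1))"
  have phi1: "0 \<le> C * \<phi> 1" using C power_type_nonneg[OF phi, of 1] by simp
  have \<delta>: "0 < \<delta>" "\<delta> \<le> 1" using D phi1 by (auto simp: \<delta>_def)
  have CD: "C * \<phi> \<delta> \<le> D"
  proof -
    have "C * \<phi> \<delta> \<le> C * (\<delta> * \<phi> 1)"
      using power_type_le_linear[OF phi, of 1 \<delta>] \<delta> C by (intro mult_left_mono) auto
    also have "\<dots> = \<delta> * (C * \<phi> 1)" by simp
    also have "\<dots> \<le> D / (C * \<phi> 1 + 1) * (C * \<phi> 1 + 1)"
      using \<delta> phi1 D by (intro mult_mono) (auto simp: \<delta>_def)
    also have "\<dots> = D" using phi1 by simp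
    finally show ?thesis .
  qed
  obtain k :: "'a \<Rightarrow> nat" where k[measurable]: "k \<in> measurable borel (count_space UNIV)"
    and cell: "\<And>x x'. k x = k x' \<Longrightarrow> dist x x' \<le> \<delta>"
    using countable_small_cells[OF \<delta>(1)] by blast
  have near: "c x' y \<le> A * c x y + D" if "k x' = k x" for x x' y
  proof -
    have "c x' y \<le> \<phi> (dist x y + dist x x')" unfolding c_def
      using dist_triangle[of x' y x] by (intro power_type_mono[OF phi]) (auto simp: dist_commute)
    also have "\<dots> \<le> A * c x y + C * \<phi> (dist x x')" unfolding c_def by (intro C) auto
    also have "C * \<phi> (dist x x') \<le> C * \<phi> \<delta>"
      using cell[OF that] C by (intro mult_left_mono power_type_mono[OF phi]) (auto simp: dist_commute)
    finally show ?thesis using CD by simp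
  qed
  have far: "c x y \<le> A * h x + C * h y" for x y
  proof -
    have "c x y \<le> \<phi> (dist x x\<^sub>0 + dist y x\<^sub>0)" unfolding c_def
      by (intro power_type_mono[OF phi]) (auto simp: dist_triangle2)
    also have "\<dots> \<le> A * h x + C * h y" unfolding h_def by (intro C) auto
    finally show ?thesis .
  qed
  have hint: "integrable \<mu> h"
  proof (rule Bochner_Integration.integrable_bound)
    show "integrable \<mu> (\<lambda>x. b * exp (h x / b))" using expint by simp
    have "h x \<le> b * exp (h x / b)" for x
    proof -
      have "h x / b \<le> exp (h x / b)" using exp_ge_add_one_self[of "h x / b"] by linarith
      then show ?thesis using b by (simp add: field_simps)
    qed
    then show "AE x in \<mu>. norm (h x) \<le> norm (b * exp (h x / b))" using h0 b by (auto simp: abs_mult)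
  qed measurable
  then have hpi: "integrable \<pi> (\<lambda>z. h (snd z))"
    using integrable_distr[of snd \<pi> borel h] couplingsD(4)[OF pi] by simp
  define v where "v = (\<lambda>n x. measure (N n) (k -` {k x}) / max (measure (N n) (k -` {k x})) (measure L (k -` {k x})))"
  define E where "E = (\<lambda>n. \<integral>z. (1 - v n (fst z)) * 1 \<partial>\<pi>)"
  define J where "J = (\<lambda>n. \<integral>z. (1 - v n (fst z)) * h (snd z) \<partial>\<pi>)"
  define S where "S = (\<lambda>n. \<integral>x. h x * indicator {x. M < h x} x \<partial>N n)"
  define I where "I = (\<lambda>n. \<integral>x. g x * indicator {x. h x \<le> M} x \<partial>N n)"
  define Z where "Z = (\<integral>x. exp (g x) \<partial>\<mu>) + (\<integral>x. exp (h x / b) * indicator {x. M < h x} x \<partial>\<mu>)"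
  have v1: "v n x \<le> 1" for n x unfolding v_def by (intro divide_max_bounds measure_nonneg)
  have E: "integrable \<pi> (\<lambda>z. (1 - v n (fst z)) * 1)" "E \<longlonglongrightarrow> 0" for n
    using cell_deficit_tendsto_0[OF N L pi conv k, of "\<lambda>_. 1"] unfolding E_def v_def by auto
  have J: "integrable \<pi> (\<lambda>z. (1 - v n (fst z)) * h (snd z))" "J \<longlonglongrightarrow> 0" for n
    using cell_deficit_tendsto_0[OF N L pi conv k hpi] unfolding J_def v_def by auto
  have E0: "0 \<le> E n" and J0: "0 \<le> J n" and S0: "0 \<le> S n" for n
    unfolding E_def J_def S_def using v1 h0 by (auto intro!: Bochner_Integration.integral_nonneg)
  define f where "f = (\<lambda>x. if h x \<le> M then g x else h x / b)"
  have [measurable]: "f \<in> borel_measurable borel" unfolding f_def by measurable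
  have fB: "- B \<le> f x" for x using B[of x] h0[of x] b unfolding f_def by (auto simp: abs_le_iff intro: order_trans[of _ 0])
  have gexp: "integrable \<mu> (\<lambda>x. exp (g x))"
    by (rule M.integrable_const_bound[where B = "exp B"]) (use B in \<open>auto simp: abs_le_iff\<close>)
  have tauint: "integrable \<mu> (\<lambda>x. exp (h x / b) * indicator {x. M < h x} x)"
    by (rule Bochner_Integration.integrable_bound[OF expint]) (auto simp: indicator_def)
  have fexp_le: "exp (f x) \<le> exp (g x) + exp (h x / b) * indicator {x. M < h x} x" for x
    by (auto simp: f_def)
  have fexp: "integrable \<mu> (\<lambda>x. exp (f x))"
    using fexp_le by (intro Bochner_Integration.integrable_bound[OF Bochner_Integration.integrable_add[OF gexp tauint]])
      (auto intro: order_trans[OF _ abs_ge_self])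
  have "(\<integral>x. exp (f x) \<partial>\<mu>) \<le> (\<integral>x. exp (g x) + exp (h x / b) * indicator {x. M < h x} x \<partial>\<mu>)"
    by (intro integral_mono fexp Bochner_Integration.integrable_add gexp tauint fexp_le)
  also have "\<dots> = Z" unfolding Z_def by (intro Bochner_Integration.integral_add gexp tauint)
  finally have Zle: "(\<integral>x. exp (f x) \<partial>\<mu>) \<le> Z" .
  have "exp (- B) \<le> (\<integral>x. exp (f x) \<partial>\<mu>)" using fB by (intro M.integral_ge_const fexp) auto
  then have fpos: "0 < (\<integral>x. exp (f x) \<partial>\<mu>)" using exp_gt_zero[of "- B"] by linarith
  \<comment> \<open>The tail \<open>S n\<close> is eliminated for each fixed n, before any limit: it
    may fail to tend to 0 when mass escapes.\<close>
  have main: "a * I n - a * ln Z \<le> (a * H n - T n) + A * C\<pi> + D + A * (M * E n) + C * J n" for n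
  proof -
    interpret Nn: prob_space "N n" by (rule p)
    have fint: "integrable (N n) f" and dv: "(\<integral>x. f x \<partial>N n) \<le> H n + ln (\<integral>x. exp (f x) \<partial>\<mu>)"
      using donsker_varadhan[OF p(1,3) _ H, of n f "- B"] fB fexp s by auto
    have gint: "integrable (N n) (\<lambda>x. g x * indicator {x. h x \<le> M} x)"
      by (rule Nn.integrable_const_bound[where B = "\<bar>B\<bar>"])
        (use B in \<open>auto simp: indicator_def intro!: order_trans[OF _ abs_ge_self]\<close>)
    have eq: "h x * indicator {x. M < h x} x = b * (f x - g x * indicator {x. h x \<le> M} x)" for x
      using b by (auto simp: f_def indicator_def)
    have Sint: "integrable (N n) (\<lambda>x. h x * indicator {x. M < h x} x)"
      unfolding eq using fint gint by simp
    have "S n = b * ((\<integral>x. f x \<partial>N n) - I n)"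
      unfolding S_def I_def eq using fint gint by simp
    then have fS: "(\<integral>x. f x \<partial>N n) = I n + S n / b" using b by simp
    have "ln (\<integral>x. exp (f x) \<partial>\<mu>) \<le> ln Z" using Zle fpos by simp
    then have "I n + S n / b \<le> H n + ln Z" using dv fS by linarith
    then have "a * (I n + S n / b) \<le> a * (H n + ln Z)" using a by (intro mult_left_mono) auto
    moreover have "A * S n \<le> a * (S n / b)"
      using A b S0[of n] mult_right_mono[of "A * b" a "S n"] by (simp add: field_simps)
    ultimately have HS: "a * I n + A * S n \<le> a * H n + a * ln Z" by (simp add: algebra_simps)
    have "ennreal (T n) \<le> ennreal A * (\<integral>\<^sup>+ z. ennreal (c (fst z) (snd z)) \<partial>\<pi>) + ennreal D
      + ennreal A * (ennreal M * (\<integral>\<^sup>+ z. ennreal (1 - v n (fst z)) \<partial>\<pi>)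
          + (\<integral>\<^sup>+ x. ennreal (h x * indicator {x. M < h x} x) \<partial>N n))
      + ennreal C * (\<integral>\<^sup>+ z. ennreal ((1 - v n (fst z)) * h (snd z)) \<partial>\<pi>)"
      unfolding T(1)[symmetric] v_def using A C D M c0 h0 near far
      by (intro transport_cost_cell_bound[OF N L pi k c h]) auto
    also have "(\<integral>\<^sup>+ z. ennreal (1 - v n (fst z)) \<partial>\<pi>) = ennreal (E n)"
      unfolding E_def using E(1)[of n] v1 by (subst nn_integral_eq_integral[symmetric]) auto
    also have "(\<integral>\<^sup>+ z. ennreal ((1 - v n (fst z)) * h (snd z)) \<partial>\<pi>) = ennreal (J n)"
      unfolding J_def using J(1)[of n] v1 h0 by (intro nn_integral_eq_integral) auto
    also have "(\<integral>\<^sup>+ x. ennreal (h x * indicator {x. M < h x} x) \<partial>N n) = ennreal (S n)"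
      unfolding S_def using h0 by (intro nn_integral_eq_integral Sint) auto
    also have "ennreal A * (\<integral>\<^sup>+ z. ennreal (c (fst z) (snd z)) \<partial>\<pi>) + ennreal D
      + ennreal A * (ennreal M * ennreal (E n) + ennreal (S n)) + ennreal C * ennreal (J n)
      = ennreal (A * C\<pi> + D + A * (M * E n + S n) + C * J n)"
      using A C D M cpi E0[of n] S0[of n] J0[of n] by (simp add: ennreal_plus ennreal_mult)
    finally have "T n \<le> A * C\<pi> + D + A * (M * E n + S n) + C * J n"
      using A C D M cpi E0[of n] S0[of n] J0[of n] by (subst (asm) ennreal_le_iff) auto
    then show ?thesis using HS by (simp add: algebra_simps)
  qed
  have "I \<longlonglongrightarrow> (\<integral>x. g x * indicator {x. h x \<le> M} x \<partial>L)"
    unfolding I_def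
    by (rule setwise_integral_tendsto[where S = borel and B = "\<bar>B\<bar>"])
      (use p s conv B in \<open>auto simp: indicator_def intro!: order_trans[OF _ abs_ge_self]\<close>)
  then have "(\<lambda>n. a * I n - a * ln Z) \<longlonglongrightarrow> a * (\<integral>x. g x * indicator {x. h x \<le> M} x \<partial>L) - a * ln Z"
    by (intro tendsto_intros)
  moreover have "(\<lambda>n. (a * H n - T n) + A * C\<pi> + D + A * (M * E n) + C * J n)
      \<longlonglongrightarrow> m + A * C\<pi> + D + A * (M * 0) + C * 0"
    by (intro tendsto_intros m E J)
  ultimately have "a * (\<integral>x. g x * indicator {x. h x \<le> M} x \<partial>L) - a * ln Z
      \<le> m + A * C\<pi> + D + A * (M * 0) + C * 0"
    using main by (intro LIMSEQ_le) auto
  then show ?thesis unfolding Z_def by simp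
qed

text \<open>Letting M tend to infinity removes the truncation of g and the exponential tail, then D
  tends to 0 and A to 1. What remains is the variational criterion for the entropy of L.\<close>

lemma entropy_le_limit_plus_cost:
  fixes \<mu> :: "'a::polish_space measure" and \<phi> :: "real \<Rightarrow> real" and x\<^sub>0 :: 'a
  defines "c \<equiv> \<lambda>x y. \<phi> (dist x y)" and "h \<equiv> \<lambda>x. \<phi> (dist x x\<^sub>0)"
  assumes mu: "\<mu> \<in> prob_measures" and phi: "power_type \<phi>"
    and N: "\<And>n. N n \<in> prob_measures" and L: "L \<in> prob_measures" and pi: "\<pi> \<in> couplings L \<mu>"
    and conv: "\<And>A. A \<in> sets borel \<Longrightarrow> (\<lambda>n. measure (N n) A) \<longlonglongrightarrow> measure L A"
    and b: "0 < b" "b < a" and expint: "integrable \<mu> (\<lambda>x. exp (h x / b))"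
    and H: "\<And>n. rel_entropy (N n) \<mu> \<le> ereal (H n)"
    and T: "\<And>n. transport_cost c (N n) \<mu> = ennreal (T n)" "\<And>n. 0 \<le> T n"
    and m: "(\<lambda>n. a * H n - T n) \<longlonglongrightarrow> m"
    and cpi: "(\<integral>\<^sup>+ z. ennreal (c (fst z) (snd z)) \<partial>\<pi>) = ennreal C\<pi>" "0 \<le> C\<pi>"
  shows "rel_entropy L \<mu> \<le> ereal ((m + C\<pi>) / a)"
proof -
  have s[measurable_cong]: "sets \<mu> = sets borel" "sets L = sets borel"
    and p: "prob_space \<mu>" "prob_space L"
    using mu L by (auto simp: prob_measures_def)
  interpret M: prob_space \<mu> by (rule p)
  interpret L: prob_space L by (rule p)
  have h[measurable]: "h \<in> borel_measurable borel" unfolding h_def by (intro measurable_power_cost phi) auto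
  show ?thesis
  proof (rule rel_entropy_leI[OF p])
    fix g B assume "g \<in> borel_measurable \<mu>" and B: "\<And>x. \<bar>g x\<bar> \<le> (B::real)"
    then have g[measurable]: "g \<in> borel_measurable borel" by (simp add: measurable_cong_sets[OF s(1) refl])
    have gint: "integrable L g" by (rule L.integrable_const_bound[where B = B]) (auto simp: B)
    have gexp: "integrable \<mu> (\<lambda>x. exp (g x))"
      by (rule M.integrable_const_bound[where B = "exp B"]) (use B in \<open>auto simp: abs_le_iff\<close>)
    define z where "z = (\<integral>x. exp (g x) \<partial>\<mu>)"
    have "exp (- B) \<le> z" unfolding z_def
      using B by (intro M.integral_ge_const gexp) (auto simp: abs_le_iff minus_le_iff)
    then have z: "0 < z" using exp_gt_zero[of "- B"] by linarith
    define I where "I = (\<lambda>n. \<integral>x. g x * indicator {x. h x \<le> real n} x \<partial>L)"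
    define \<tau> where "\<tau> = (\<lambda>n. \<integral>x. exp (h x / b) * indicator {x. real n < h x} x \<partial>\<mu>)"
    have ev: "\<forall>\<^sub>F n in sequentially. h x \<le> real n" for x by real_asymp
    have "I \<longlonglongrightarrow> (\<integral>x. g x \<partial>L)" unfolding I_def
    proof (rule integral_dominated_convergence[where w = "\<lambda>x. norm (g x)"])
      show "AE x in L. (\<lambda>n. g x * indicator {x. h x \<le> real n} x) \<longlonglongrightarrow> g x"
      proof (intro AE_I2)
        fix x
        show "(\<lambda>n. g x * indicator {x. h x \<le> real n} x) \<longlonglongrightarrow> g x"
          using ev[of x] by (intro tendsto_eventually) (elim eventually_mono, simp)
      qed
    qed (use gint in \<open>auto simp: indicator_def\<close>)
    moreover have "\<tau> \<longlonglongrightarrow> (\<integral>x. 0 \<partial>\<mu>)" unfolding \<tau>_def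
    proof (rule integral_dominated_convergence[where w = "\<lambda>x. exp (h x / b)"])
      show "AE x in \<mu>. (\<lambda>n. exp (h x / b) * indicator {x. real n < h x} x) \<longlonglongrightarrow> 0"
      proof (intro AE_I2)
        fix x
        show "(\<lambda>n. exp (h x / b) * indicator {x. real n < h x} x) \<longlonglongrightarrow> 0"
          using ev[of x] by (intro tendsto_eventually) (elim eventually_mono, simp)
      qed
    qed (use expint in \<open>auto simp: indicator_def\<close>)
    ultimately have lim: "(\<lambda>n. a * I n - a * ln (z + \<tau> n)) \<longlonglongrightarrow> a * (\<integral>x. g x \<partial>L) - a * ln (z + 0)"
      using z by (intro tendsto_intros) auto
    have A_bound: "a * (\<integral>x. g x \<partial>L) - a * ln z \<le> m + A * C\<pi>" if A: "1 < A" "A * b \<le> a" for A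
    proof (rule field_le_epsilon)
      fix D :: real assume D: "0 < D"
      have "a * I n - a * ln (z + \<tau> n) \<le> m + A * C\<pi> + D" for n
        unfolding I_def \<tau>_def z_def h_def
        by (rule entropy_minus_transport_limit[where N = N and H = H and T = T and \<pi> = \<pi> and B = B])
          (use mu phi N L pi conv b expint H T m cpi A D g B in \<open>auto simp: c_def h_def\<close>)
      then show "a * (\<integral>x. g x \<partial>L) - a * ln z \<le> m + A * C\<pi> + D"
        using LIMSEQ_le_const2[OF lim] by auto
    qed
    \<comment> \<open>Admissible values of A fill the interval from 1, excluded, to a / b. This
      sequence starts at a / b and decreases to 1.\<close>
    have "(\<lambda>n. m + (1 + (a / b - 1) / real (Suc n)) * C\<pi>) \<longlonglongrightarrow> m + (1 + 0) * C\<pi>"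
      by (intro tendsto_intros LIMSEQ_Suc[OF lim_const_over_n])
    moreover have "a * (\<integral>x. g x \<partial>L) - a * ln z \<le> m + (1 + (a / b - 1) / real (Suc n)) * C\<pi>" for n
    proof (rule A_bound)
      have ab: "0 < a / b - 1" using b by simp
      show "1 < 1 + (a / b - 1) / real (Suc n)" using ab by simp
      have "(a / b - 1) / real (Suc n) \<le> (a / b - 1) / 1" using ab by (intro divide_left_mono) auto
      then have "(1 + (a / b - 1) / real (Suc n)) * b \<le> (a / b) * b" using b by (intro mult_right_mono) auto
      then show "(1 + (a / b - 1) / real (Suc n)) * b \<le> a" using b by simp
    qed
    ultimately have "a * (\<integral>x. g x \<partial>L) - a * ln z \<le> m + (1 + 0) * C\<pi>"
      by (intro LIMSEQ_le_const) auto
    then show "(\<integral>x. g x \<partial>L) \<le> (m + C\<pi>) / a + ln (\<integral>x. exp (g x) \<partial>\<mu>)"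
      unfolding z_def[symmetric] using b by (simp add: field_simps)
  qed (simp add: s)
qed

section \<open>Coercivity and existence of the minimizer\<close>

lemma entropy_uniformly_absolutely_continuous:
  assumes "prob_space \<mu>" and e: "0 < e" and K: "0 \<le> K"
  obtains d where "0 < d"
    "\<And>\<nu> A. prob_space \<nu> \<Longrightarrow> sets \<nu> = sets \<mu> \<Longrightarrow> rel_entropy \<nu> \<mu> \<le> ereal K \<Longrightarrow> A \<in> sets \<mu> \<Longrightarrow>
      measure \<mu> A < d \<Longrightarrow> measure \<nu> A < e"
proof -
  interpret M: prob_space \<mu> by fact
  \<comment> \<open>Testing with t times the indicator of A gives t \<nu>(A) \<le> K + exp(t)
    \<mu>(A). For \<mu>(A) < exp(-t) the right side is below K + 1, which is t e for this
    choice.\<close>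
  define t where "t = (K + 1) / e"
  have t: "0 < t" using e K by (simp add: t_def)
  show thesis
  proof
    show "0 < exp (- t)" by simp
    fix \<nu> A assume nu: "prob_space \<nu>" "sets \<nu> = sets \<mu>" "rel_entropy \<nu> \<mu> \<le> ereal K"
      and A[measurable]: "A \<in> sets \<mu>" and small: "measure \<mu> A < exp (- t)"
    have [measurable_cong]: "sets \<nu> = sets \<mu>" by fact
    have eq: "exp (t * indicator A x) = 1 + (exp t - 1) * indicator A x" for x
      by (auto simp: indicator_def)
    have int: "integrable \<mu> (\<lambda>x. exp (t * indicator A x))" unfolding eq
      by (auto simp: M.emeasure_eq_measure)
    have Z: "(\<integral>x. exp (t * indicator A x) \<partial>\<mu>) = 1 + (exp t - 1) * measure \<mu> A"
      unfolding eq by (subst Bochner_Integration.integral_add) (auto simp: M.prob_space M.emeasure_eq_measure)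
    have pos: "0 \<le> (exp t - 1) * measure \<mu> A" using t by simp
    have "t * measure \<nu> A = (\<integral>x. t * indicator A x \<partial>\<nu>)" by simp
    also have "\<dots> \<le> K + ln (\<integral>x. exp (t * indicator A x) \<partial>\<mu>)"
      using t by (intro donsker_varadhan(2)[OF assms(1) nu _ _ int, of 0]) auto
    also have "\<dots> \<le> K + (exp t - 1) * measure \<mu> A"
      unfolding Z using ln_add_one_self_le_self[OF pos] by simp
    also have "(exp t - 1) * measure \<mu> A \<le> exp t * measure \<mu> A" by (simp add: left_diff_distrib)
    also have "K + exp t * measure \<mu> A < K + exp t * exp (- t)"
      using small by (intro add_strict_left_mono mult_strict_left_mono) auto
    also have "\<dots> = t * e" using e by (simp add: t_def exp_minus)
    finally show "measure \<nu> A < e" using t by simp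
  qed
qed

text \<open>The product coupling is crude but sufficient for finiteness and for coercivity, because
  the constant before the \<nu>-integral of h is only A.\<close>

lemma transport_cost_le_product:
  fixes \<nu> \<mu> :: "'a::topological_space measure" and c :: "'a \<Rightarrow> 'a \<Rightarrow> real"
  assumes nu: "\<nu> \<in> prob_measures" and mu: "\<mu> \<in> prob_measures"
    and hn: "integrable \<nu> h" and hm: "integrable \<mu> h" and pos: "0 \<le> A" "0 \<le> C" "\<And>x. 0 \<le> h x"
    and far: "\<And>x y. c x y \<le> A * h x + C * h y"
  shows "transport_cost c \<nu> \<mu> \<le> ennreal (A * (\<integral>x. h x \<partial>\<nu>) + C * (\<integral>x. h x \<partial>\<mu>))"
proof -
  have "prob_space \<nu>" "prob_space \<mu>" using assms by (auto simp: prob_measures_def)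
  interpret N: prob_space \<nu> by fact
  interpret M: prob_space \<mu> by fact
  have [measurable]: "h \<in> borel_measurable \<nu>" "h \<in> borel_measurable \<mu>" using hn hm by auto
  have "transport_cost c \<nu> \<mu> \<le> (\<integral>\<^sup>+ z. ennreal (c (fst z) (snd z)) \<partial>(\<nu> \<Otimes>\<^sub>M \<mu>))"
    unfolding transport_cost_def by (intro INF_lower product_in_couplings nu mu)
  also have "\<dots> \<le> (\<integral>\<^sup>+ z. ennreal A * ennreal (h (fst z)) + ennreal C * ennreal (h (snd z)) \<partial>(\<nu> \<Otimes>\<^sub>M \<mu>))"
    using far pos by (intro nn_integral_mono) (simp add: ennreal_mult[symmetric] ennreal_plus[symmetric] ennreal_leI del: ennreal_plus)
  also have "\<dots> = (\<integral>\<^sup>+ x. \<integral>\<^sup>+ y. ennreal A * ennreal (h x) + ennreal C * ennreal (h y) \<partial>\<mu> \<partial>\<nu>)"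
    by (subst M.nn_integral_fst[symmetric]) auto
  also have "\<dots> = ennreal A * (\<integral>\<^sup>+ x. ennreal (h x) \<partial>\<nu>) + ennreal C * (\<integral>\<^sup>+ x. ennreal (h x) \<partial>\<mu>)"
    by (simp add: nn_integral_add nn_integral_cmult M.emeasure_space_1 N.emeasure_space_1)
  also have "\<dots> = ennreal (A * (\<integral>x. h x \<partial>\<nu>) + C * (\<integral>x. h x \<partial>\<mu>))"
    using pos by (simp add: nn_integral_eq_integral hn hm ennreal_mult ennreal_plus)
  finally show ?thesis .
qed

theorem theorem2p9:
  fixes \<mu> :: "'a::polish_space measure" and \<phi> :: "real \<Rightarrow> real" and a' r\<^sub>o :: real
  defines "c \<equiv> \<lambda>x y. \<phi> (dist x y)"
  defines "p\<^sub>o \<equiv> power_exponent \<phi>"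
  defines "dt \<equiv> \<lambda>x y. (c x y) powr (1 / p\<^sub>o)"
  assumes mu: "\<mu> \<in> prob_measures"
    and phi: "power_type \<phi>"
    and a'_pos: "a' > 0" and ro: "r\<^sub>o \<ge> 0"
    and conc: "\<And>A r. A \<in> sets borel \<Longrightarrow> measure \<mu> A \<ge> 1/2 \<Longrightarrow> r \<ge> r\<^sub>o \<Longrightarrow>
        measure (completion \<mu>) (enlargement dt A r) \<ge> 1 - exp (- ((r - r\<^sub>o) powr p\<^sub>o) / a')"
  shows "\<forall>a>a'. \<exists>\<nu>\<in>{\<nu>\<in>prob_measures. rel_entropy \<nu> \<mu> < \<infinity>}.
           \<forall>\<nu>'\<in>{\<nu>\<in>prob_measures. rel_entropy \<nu> \<mu> < \<infinity>}.
             ereal a * rel_entropy \<nu> \<mu> - enn2ereal (transport_cost c \<nu> \<mu>)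
             \<le> ereal a * rel_entropy \<nu>' \<mu> - enn2ereal (transport_cost c \<nu>' \<mu>)"
proof (intro allI impI)
  fix a assume a: "a' < a"
  define x\<^sub>0 :: 'a where "x\<^sub>0 = undefined"
  define h where "h = (\<lambda>x. \<phi> (dist x x\<^sub>0))"
  define b where "b = (a' + a) / 2"
  have b: "a' < b" "b < a" "0 < b" using a a'_pos by (auto simp: b_def)
  have s: "sets \<mu> = sets borel" and pmu: "prob_space \<mu>" using mu by (auto simp: prob_measures_def)
  interpret M: prob_space \<mu> by (rule pmu)
  have hb: "h \<in> borel_measurable borel" unfolding h_def by (intro measurable_power_cost phi) auto
  then have h[measurable]: "h \<in> borel_measurable \<mu>" by (simp add: measurable_cong_sets[OF s refl])
  have h0: "0 \<le> h x" for x unfolding h_def by (auto intro: power_type_nonneg[OF phi])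
  have expint: "integrable \<mu> (\<lambda>x. exp (h x / b))"
    unfolding h_def
    by (rule concentration_exp_integrable[OF mu phi a'_pos _ b(1)])
      (use conc in \<open>auto simp: dt_def c_def p\<^sub>o_def\<close>)
  \<comment> \<open>The midpoint of 1 and a / b: the strict inequality A b < a is what makes the
    functional coercive.\<close>
  define A where "A = (1 + a / b) / 2"
  have A: "1 < A" "A * b < a" using b by (auto simp: A_def field_simps)
  obtain C where C: "0 \<le> C" "\<And>s t. 0 \<le> s \<Longrightarrow> 0 \<le> t \<Longrightarrow> \<phi> (s + t) \<le> A * \<phi> s + C * \<phi> t"
    using power_type_almost_subadditive[OF phi A(1)] by blast
  have far: "c x y \<le> A * h x + C * h y" for x y
  proof -
    have "c x y \<le> \<phi> (dist x x\<^sub>0 + dist y x\<^sub>0)" unfolding c_def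
      by (intro power_type_mono[OF phi]) (auto simp: dist_triangle2)
    also have "\<dots> \<le> A * h x + C * h y" unfolding h_def by (intro C) auto
    finally show ?thesis .
  qed
  define S where "S = {\<nu> \<in> prob_measures. rel_entropy \<nu> \<mu> < \<infinity>}"
  define H where "H = (\<lambda>\<nu>. real_of_ereal (rel_entropy \<nu> \<mu>))"
  define T where "T = (\<lambda>\<nu>. enn2real (transport_cost c \<nu> \<mu>))"
  define Z where "Z = ln (\<integral>x. exp (h x / b) \<partial>\<mu>)"
  have SD: "\<nu> \<in> prob_measures" "prob_space \<nu>" "sets \<nu> = sets \<mu>" if "\<nu> \<in> S" for \<nu>
    using that s by (auto simp: S_def prob_measures_def)
  have H0: "0 \<le> rel_entropy \<nu> \<mu>" if "\<nu> \<in> S" for \<nu>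
    using SD[OF that] pmu by (intro rel_entropy_nonneg) auto
  have H: "rel_entropy \<nu> \<mu> = ereal (H \<nu>)" "0 \<le> H \<nu>" if "\<nu> \<in> S" for \<nu>
    using H0[OF that] that unfolding H_def S_def by (cases "rel_entropy \<nu> \<mu>"; simp)+
  have muS: "\<mu> \<in> S" unfolding S_def using mu rel_entropy_self[OF pmu] by (auto intro: le_less_trans)
  have hint: "integrable \<nu> h" "(\<integral>x. h x \<partial>\<nu>) \<le> b * (H \<nu> + Z)" if "\<nu> \<in> S" for \<nu>
  proof -
    have "integrable \<nu> (\<lambda>x. h x / b)" "(\<integral>x. h x / b \<partial>\<nu>) \<le> H \<nu> + Z"
      unfolding Z_def using donsker_varadhan[OF pmu SD(2,3)[OF that], of "H \<nu>" "\<lambda>x. h x / b" 0] h0 b expint H[OF that]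
      by auto
    then show "(\<integral>x. h x \<partial>\<nu>) \<le> b * (H \<nu> + Z)"
      using b by (simp add: field_simps)
    have "integrable \<nu> (\<lambda>x. b * (h x / b))"
      by (rule integrable_mult_right) (rule \<open>integrable \<nu> (\<lambda>x. h x / b)\<close>)
    then show "integrable \<nu> h" using b by simp
  qed
  define K where "K = A * b * Z + C * (\<integral>x. h x \<partial>\<mu>)"
  have Tle: "transport_cost c \<nu> \<mu> \<le> ennreal (A * b * H \<nu> + K)" if "\<nu> \<in> S" for \<nu>
  proof -
    have "transport_cost c \<nu> \<mu> \<le> ennreal (A * (\<integral>x. h x \<partial>\<nu>) + C * (\<integral>x. h x \<partial>\<mu>))"
      using A C h0 far by (intro transport_cost_le_product SD[OF that] mu hint that muS) auto
    also have "\<dots> \<le> ennreal (A * (b * (H \<nu> + Z)) + C * (\<integral>x. h x \<partial>\<mu>))"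
      using A hint(2)[OF that] by (intro ennreal_leI add_right_mono mult_left_mono) auto
    finally show ?thesis by (simp add: K_def algebra_simps)
  qed
  have T: "transport_cost c \<nu> \<mu> = ennreal (T \<nu>)" "0 \<le> T \<nu>" if "\<nu> \<in> S" for \<nu>
    using le_less_trans[OF Tle[OF that] ennreal_less_top] by (auto simp: T_def)
  have K0: "0 \<le> A * b * H \<nu> + K" if "\<nu> \<in> S" for \<nu>
  proof -
    have "0 \<le> A * (\<integral>x. h x \<partial>\<nu>) + C * (\<integral>x. h x \<partial>\<mu>)"
      using A C h0 by (intro add_nonneg_nonneg mult_nonneg_nonneg Bochner_Integration.integral_nonneg) auto
    also have "\<dots> \<le> A * (b * (H \<nu> + Z)) + C * (\<integral>x. h x \<partial>\<mu>)"
      using A hint(2)[OF that] by (intro add_right_mono mult_left_mono) auto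
    finally show ?thesis by (simp add: K_def algebra_simps)
  qed
  have TH: "T \<nu> \<le> A * b * H \<nu> + K" if "\<nu> \<in> S" for \<nu>
    using Tle[OF that] unfolding T(1)[OF that] using K0[OF that] by simp
  define F where "F = (\<lambda>\<nu>. a * H \<nu> - T \<nu>)"
  \<comment> \<open>This yields both a lower bound for F and an entropy bound along any minimizing
    sequence.\<close>
  have coercive: "(a - A * b) * H \<nu> \<le> F \<nu> + K" if "\<nu> \<in> S" for \<nu>
    using TH[OF that] by (simp add: F_def algebra_simps)
  have Fbdd: "bdd_below (F ` S)"
  proof (rule bdd_belowI2)
    fix \<nu> assume "\<nu> \<in> S"
    then have "0 \<le> (a - A * b) * H \<nu>" using A H by (intro mult_nonneg_nonneg) auto
    then show "- K \<le> F \<nu>" using coercive[OF \<open>\<nu> \<in> S\<close>] by linarith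
  qed
  define m where "m = (INF \<nu>\<in>S. F \<nu>)"
  have "\<exists>\<nu>\<in>S. F \<nu> < m + 1 / real (Suc n)" for n
    using muS Fbdd cINF_less_iff[of S F "m + 1 / real (Suc n)"] unfolding m_def by auto
  then obtain N where N: "\<And>n. N n \<in> S" "\<And>n. F (N n) < m + 1 / real (Suc n)" by metis
  have mle: "m \<le> F \<nu>" if "\<nu> \<in> S" for \<nu> unfolding m_def using Fbdd that by (rule cINF_lower)
  have Flim: "(\<lambda>n. F (N n)) \<longlonglongrightarrow> m"
  proof (rule real_tendsto_sandwich)
    show "(\<lambda>n. m) \<longlonglongrightarrow> m" by simp
    show "(\<lambda>n. m + 1 / real (Suc n)) \<longlonglongrightarrow> m" by real_asymp
  qed (use mle N in \<open>auto intro!: always_eventually less_imp_le\<close>)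
  define K' where "K' = (m + 1 + K) / (a - A * b)"
  have HK: "H (N n) \<le> K'" for n
  proof -
    have "1 / real (Suc n) \<le> 1" by simp
    then have "(a - A * b) * H (N n) \<le> m + 1 + K" using coercive[OF N(1)[of n]] N(2)[of n] by linarith
    then show ?thesis using A by (simp add: K'_def field_simps)
  qed
  then have K'0: "0 \<le> K'" using H(2)[OF N(1)] order_trans by blast
  have HK': "rel_entropy (N n) \<mu> \<le> ereal K'" for n using HK H(1)[OF N(1)] by simp
  obtain r L where r: "strict_mono (r :: nat \<Rightarrow> nat)" and L: "L \<in> prob_measures"
    and conv: "\<And>A. A \<in> sets borel \<Longrightarrow> (\<lambda>n. measure (N (r n)) A) \<longlonglongrightarrow> measure L A"
  proof (rule setwise_sequentially_compact[OF mu SD(1)[OF N(1)]])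
    fix e :: real assume "0 < e"
    then obtain d where "0 < d" "\<And>\<nu> A. prob_space \<nu> \<Longrightarrow> sets \<nu> = sets \<mu> \<Longrightarrow> rel_entropy \<nu> \<mu> \<le> ereal K' \<Longrightarrow>
        A \<in> sets \<mu> \<Longrightarrow> measure \<mu> A < d \<Longrightarrow> measure \<nu> A < e"
      using entropy_uniformly_absolutely_continuous[OF pmu _ K'0] by metis
    then show "\<exists>d>0. \<forall>n. \<forall>A\<in>sets borel. measure \<mu> A < d \<longrightarrow> measure (N n) A < e"
      using SD(2,3)[OF N(1)] HK' s by auto
  qed blast
  have pL: "prob_space L" "sets L = sets \<mu>" using L s by (auto simp: prob_measures_def)
  \<comment> \<open>This bound places L in \<open>S\<close>, so that its entropy and transport cost
    are real numbers before the sharper comparison with m.\<close>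
  have "rel_entropy L \<mu> \<le> ereal K'"
  proof (rule rel_entropy_leI[OF pmu pL])
    fix g B assume g: "g \<in> borel_measurable \<mu>" and B: "\<And>x. \<bar>g x\<bar> \<le> (B::real)"
    have gexp: "integrable \<mu> (\<lambda>x. exp (g x))"
      by (rule M.integrable_const_bound[where B = "exp B"]) (use g B in \<open>auto simp: abs_le_iff\<close>)
    have "(\<lambda>n. \<integral>x. g x \<partial>N (r n)) \<longlonglongrightarrow> (\<integral>x. g x \<partial>L)"
      by (rule setwise_integral_tendsto[where S = \<mu> and B = B]) (use SD[OF N(1)] pL g B conv s in auto)
    moreover have "- B \<le> g x" for x using B[of x] by linarith
    then have "(\<integral>x. g x \<partial>N (r n)) \<le> K' + ln (\<integral>x. exp (g x) \<partial>\<mu>)" for n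
      using SD[OF N(1)] by (intro donsker_varadhan(2)[OF pmu _ _ HK' g _ gexp]) auto
    ultimately show "(\<integral>x. g x \<partial>L) \<le> K' + ln (\<integral>x. exp (g x) \<partial>\<mu>)"
      by (intro LIMSEQ_le_const2) auto
  qed
  then have LS: "L \<in> S" unfolding S_def using L by (auto intro: le_less_trans)
  have Fr: "(\<lambda>n. a * H (N (r n)) - T (N (r n))) \<longlonglongrightarrow> m"
    using LIMSEQ_subseq_LIMSEQ[OF Flim r] by (simp add: F_def o_def)
  \<comment> \<open>Lower semicontinuity, F(L) \<le> m, is rearranged as a lower bound on the
    transport cost, so that it can be checked one coupling at a time; couplings of infinite cost are
    trivial.\<close>
  have "ennreal (a * H L - m) \<le> transport_cost c L \<mu>"
    unfolding transport_cost_def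
  proof (rule INF_greatest)
    fix \<pi> assume pi: "\<pi> \<in> couplings L \<mu>"
    show "ennreal (a * H L - m) \<le> (\<integral>\<^sup>+ z. ennreal (c (fst z) (snd z)) \<partial>\<pi>)"
    proof (cases "\<integral>\<^sup>+ z. ennreal (c (fst z) (snd z)) \<partial>\<pi>")
      case (real q)
      have "rel_entropy L \<mu> \<le> ereal ((m + q) / a)"
        by (rule entropy_le_limit_plus_cost[where N = "\<lambda>n. N (r n)" and H = "\<lambda>n. H (N (r n))"
              and T = "\<lambda>n. T (N (r n))" and b = b and \<phi> = \<phi> and x\<^sub>0 = x\<^sub>0 and \<pi> = \<pi>])
          (use mu phi SD N L pi conv b expint H T Fr real in \<open>auto simp: c_def h_def\<close>)
      then have "H L \<le> (m + q) / a" using H(1)[OF LS] by simp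
      then show ?thesis using a a'_pos real by (auto simp: field_simps intro!: ennreal_leI)
    qed simp
  qed
  then have "F L \<le> m" unfolding T(1)[OF LS] F_def using T(2)[OF LS] by (simp add: ennreal_le_iff)
  then have min: "F L \<le> F \<nu>" if "\<nu> \<in> S" for \<nu> using mle[OF that] by linarith
  have FE: "ereal a * rel_entropy \<nu> \<mu> - enn2ereal (transport_cost c \<nu> \<mu>) = ereal (F \<nu>)" if "\<nu> \<in> S" for \<nu>
    unfolding H(1)[OF that] T(1)[OF that] F_def using T(2)[OF that] by (simp add: enn2ereal_ennreal)
  show "\<exists>\<nu>\<in>{\<nu>\<in>prob_measures. rel_entropy \<nu> \<mu> < \<infinity>}.
           \<forall>\<nu>'\<in>{\<nu>\<in>prob_measures. rel_entropy \<nu> \<mu> < \<infinity>}.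
             ereal a * rel_entropy \<nu> \<mu> - enn2ereal (transport_cost c \<nu> \<mu>)
             \<le> ereal a * rel_entropy \<nu>' \<mu> - enn2ereal (transport_cost c \<nu>' \<mu>)"
    unfolding S_def[symmetric] using LS min FE by (intro bexI[of _ L] ballI) auto
qed

end
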